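(* Let $G(q)$ and $H(q)$ be the Rogers--Ramanujan functions. Then $$G(q)=\frac{1}{(q^5;q^5)_\infty}\sum_{n=0}^\infty\mathrm{cp}_{1,4,5}(n)q^n \qquad\text{and}\qquad H(q)=\frac{1}{(q^5;q^5)_\infty}\sum_{n=0}^\infty\mathrm{cp}_{2,3,5}(n)q^n.$$
   Context: Notation: $(A;Q)_n=\prod_{k=0}^{n-1}(1-AQ^k)$ and $(A;Q)_\infty=\prod_{k=0}^{\infty}(1-AQ^k)$, for $|Q|<1$ or as formal power series. The Rogers--Ramanujan functions are $$G(q):=\sum_{n=0}^\infty\frac{q^{n^2}}{(q;q)_n}=\frac{1}{(q;q^5)_\infty(q^4;q^5)_\infty},\qquad H(q):=\sum_{n=0}^\infty \frac{q^{n^2+n}}{(q;q)_n}=\frac{1}{(q^2;q^5)_\infty(q^3;q^5)_\infty},$$ where the equalities of sum and product are the classical Rogers--Ramanujan identities. A partition is a finite multiset of positive integers (its parts), possibly empty; its size $|\lambda|$ is the sum of its parts. For integers $a,b,m\ge 1$, an $(a,b,m)$-copartition is a triple of partitions $(\gamma,\rho,\sigma)$ such that each part of $\gamma$ is at least $a$ and congruent to $a \pmod m$, each part of $\sigma$ is at least $b$ and congruent to $b\pmod m$, and $\rho$ has the same number of parts as $\sigma$, each of which has size equal to $m$ times the number of parts of $\gamma$ (if $\gamma$ is empty, $\rho$ is regarded as empty). Its size is $|\gamma|+|\rho|+|\sigma|$. Let $\mathrm{cp}_{a,b,m}(n)$ denote the number of $(a,b,m)$-copartitions of size $n$. *)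

theory Defs
  imports
    "HOL-Analysis.Infinite_Products"
    "HOL-Computational_Algebra.Formal_Power_Series"
    "HOL-Library.Multiset"
    "HOL-Number_Theory.Cong"
begin

unbundle no vec_syntax
unbundle fps_syntax

text \<open>
  All \<open>q\<close>-series are formal power series over a field of characteristic 0, with \<open>q = fps_X\<close>.
  The infinite sums and products below are limits in the \<open>fps_X\<close>-adic metric that the library puts
  on \<open>'a fps\<close>.
\<close>

definition qpoch :: "'a::comm_ring_1 \<Rightarrow> 'a \<Rightarrow> nat \<Rightarrow> 'a" where
  "qpoch A Q n = (\<Prod>k<n. 1 - A * Q ^ k)"

definition qpoch_inf :: "'a::{comm_ring_1,t2_space} \<Rightarrow> 'a \<Rightarrow> 'a" where
  "qpoch_inf A Q = (\<Prod>k. 1 - A * Q ^ k)"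

definition rogers_ramanujan_G :: "'a::field_char_0 fps" where
  "rogers_ramanujan_G = (\<Sum>n. fps_X ^ (n\<^sup>2) / qpoch fps_X fps_X n)"

definition rogers_ramanujan_H :: "'a::field_char_0 fps" where
  "rogers_ramanujan_H = (\<Sum>n. fps_X ^ (n\<^sup>2 + n) / qpoch fps_X fps_X n)"

definition is_partition :: "nat multiset \<Rightarrow> bool" where
  "is_partition P \<longleftrightarrow> (\<forall>x \<in># P. x > 0)"

text \<open>
  If \<open>\<gamma>\<close> is empty, the parts of \<open>\<rho>\<close> would all be zero; by convention \<open>\<rho>\<close> is then empty, even if
  \<open>\<sigma>\<close> is not.
\<close>

definition copartition ::
    "nat \<Rightarrow> nat \<Rightarrow> nat \<Rightarrow> nat multiset \<times> nat multiset \<times> nat multiset \<Rightarrow> bool" where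
  "copartition a b m = (\<lambda>(\<gamma>, \<rho>, \<sigma>).
     is_partition \<gamma> \<and> is_partition \<rho> \<and> is_partition \<sigma> \<and>
     (\<forall>x \<in># \<gamma>. a \<le> x \<and> [x = a] (mod m)) \<and>
     (\<forall>x \<in># \<sigma>. b \<le> x \<and> [x = b] (mod m)) \<and>
     (if \<gamma> = {#} then \<rho> = {#}
      else size \<rho> = size \<sigma> \<and> (\<forall>x \<in># \<rho>. x = m * size \<gamma>)))"

definition copartition_size :: "nat multiset \<times> nat multiset \<times> nat multiset \<Rightarrow> nat" where
  "copartition_size = (\<lambda>(\<gamma>, \<rho>, \<sigma>). sum_mset \<gamma> + sum_mset \<rho> + sum_mset \<sigma>)"

definition cp :: "nat \<Rightarrow> nat \<Rightarrow> nat \<Rightarrow> nat \<Rightarrow> nat" where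
  "cp a b m n = card {c. copartition a b m c \<and> copartition_size c = n}"

text \<open>
  Well-definedness: \<open>card\<close> is applied to finite sets only, and the series and the product converge.
\<close>

lemma size_le_sum_mset_if_is_partition: "is_partition P \<Longrightarrow> size P \<le> sum_mset P"
  unfolding is_partition_def by (induction P) (auto simp: Suc_le_eq add_strict_increasing)

lemma finite_partitions_bounded: "finite {P. is_partition P \<and> sum_mset P \<le> n}"
proof (rule finite_subset)
  show "{P. is_partition P \<and> sum_mset P \<le> n} \<subseteq> (\<Union>k\<le>n. multisets_of_size {..n} k)"
  proof
    fix P assume P: "P \<in> {P. is_partition P \<and> sum_mset P \<le> n}"
    then have "size P \<le> n"
      using size_le_sum_mset_if_is_partition[of P] by simp
    moreover have "x \<le> n" if "x \<in># P" for x
      using P multi_member_split[OF that] by auto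
    ultimately show "P \<in> (\<Union>k\<le>n. multisets_of_size {..n} k)"
      by (auto simp: multisets_of_size_def)
  qed
qed auto

lemma finite_copartitions: "finite {c. copartition a b m c \<and> copartition_size c = n}"
proof (rule finite_subset)
  let ?S = "{P. is_partition P \<and> sum_mset P \<le> n}"
  show "{c. copartition a b m c \<and> copartition_size c = n} \<subseteq> ?S \<times> ?S \<times> ?S"
    by (auto simp: copartition_def copartition_size_def)
qed (use finite_partitions_bounded in auto)

lemma summable_fps_X_power:
  fixes g :: "nat \<Rightarrow> 'a::comm_ring_1 fps"
  assumes "\<And>n. n \<le> e n"
  shows "summable (\<lambda>n. fps_X ^ e n * g n)"
proof -
  let ?f = "\<lambda>n. fps_X ^ e n * g n"
  have *: "?f n $ k = 0" if "k < n" for n k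
    using assms[of n] that by (simp add: fps_X_power_mult_nth)
  have "(\<lambda>N. \<Sum>n<N. ?f n) \<longlonglongrightarrow> Abs_fps (\<lambda>k. (\<Sum>n\<le>k. ?f n) $ k)"
  proof (rule tendsto_fpsI)
    fix k
    have "(\<Sum>n<N. ?f n) $ k = Abs_fps (\<lambda>k. (\<Sum>n\<le>k. ?f n) $ k) $ k" if "N > k" for N
    proof -
      have "(\<Sum>n<N. ?f n $ k) = (\<Sum>n\<le>k. ?f n $ k)"
        by (rule sum.mono_neutral_right) (use that * in auto)
      then show ?thesis by (simp add: fps_sum_nth)
    qed
    then show "\<forall>\<^sub>F N in sequentially. (\<Sum>n<N. ?f n) $ k = Abs_fps (\<lambda>k. (\<Sum>n\<le>k. ?f n) $ k) $ k"
      by (rule eventually_mono[OF eventually_gt_at_top[of k]])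
  qed
  then show ?thesis
    by (auto simp: summable_def sums_def)
qed

lemma qpoch_fps_X_nth_0: "qpoch (fps_X :: 'a::field fps) fps_X n $ 0 = 1"
  unfolding qpoch_def by (induction n) (simp_all add: fps_mult_nth_0)

lemma
  shows summable_rogers_ramanujan_G:
    "summable (\<lambda>n. fps_X ^ (n\<^sup>2) / qpoch fps_X (fps_X :: 'a::field fps) n)"
  and summable_rogers_ramanujan_H:
    "summable (\<lambda>n. fps_X ^ (n\<^sup>2 + n) / qpoch fps_X (fps_X :: 'a::field fps) n)"
  using summable_fps_X_power[of "\<lambda>n. n\<^sup>2" "\<lambda>n. inverse (qpoch fps_X (fps_X :: 'a fps) n)"]
    summable_fps_X_power[of "\<lambda>n. n\<^sup>2 + n" "\<lambda>n. inverse (qpoch fps_X (fps_X :: 'a fps) n)"]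
  by (simp_all add: fps_divide_unit qpoch_fps_X_nth_0 power2_nat_le_imp_le power2_eq_square)

lemma has_prod_qpoch_inf:
  fixes r s :: nat
  assumes "r > 0" "s > 0"
  shows "(\<lambda>k. 1 - fps_X ^ r * (fps_X ^ s) ^ k) has_prod
    qpoch_inf (fps_X ^ r) (fps_X ^ s :: 'a::field fps)"
proof -
  let ?f = "\<lambda>k. 1 - fps_X ^ r * (fps_X ^ s) ^ k :: 'a fps"
  let ?p = "\<lambda>N. \<Prod>k\<le>N. ?f k"
  have f: "?f k = 1 - fps_X ^ (r + s * k)" for k
    by (simp add: power_add power_mult)
  have dist: "P * (1 - x) = P - x * P" for P x :: "'a fps"
    by (simp add: algebra_simps)
  have step: "?p (Suc N) $ k = ?p N $ k" if "k \<le> N" for N k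
  proof -
    have "N \<le> s * N" using assms by simp
    with that have "k < r + s * Suc N" using assms unfolding mult_Suc_right by linarith
    then have "(fps_X ^ (r + s * Suc N) * ?p N) $ k = 0"
      by (simp only: fps_X_power_mult_nth if_True)
    moreover have "?p (Suc N) = ?p N - fps_X ^ (r + s * Suc N) * ?p N"
      unfolding prod.atMost_Suc f by (rule dist)
    ultimately show ?thesis by simp
  qed
  have stable: "?p N $ k = ?p k $ k" if "k \<le> N" for N k
    using that by (induction N rule: dec_induct) (simp_all only: step)
  have "?p \<longlonglongrightarrow> Abs_fps (\<lambda>k. ?p k $ k)"
  proof (rule tendsto_fpsI)
    fix k
    show "\<forall>\<^sub>F N in sequentially. ?p N $ k = Abs_fps (\<lambda>k. ?p k $ k) $ k"
      unfolding fps_nth_Abs_fps by (rule eventually_mono[OF eventually_ge_at_top[of k] stable])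
  qed
  moreover have "Abs_fps (\<lambda>k. ?p k $ k) $ 0 \<noteq> 0"
    using assms by (simp add: fps_mult_nth_0 fps_X_power_nth)
  then have "Abs_fps (\<lambda>k. ?p k $ k) \<noteq> 0" by (rule fps_nonzeroI)
  ultimately have "?f has_prod Abs_fps (\<lambda>k. ?p k $ k)"
    unfolding has_prod_def raw_has_prod_def add_0_right by blast
  then show ?thesis
    unfolding qpoch_inf_def by (simp only: has_prod_unique[symmetric])
qed

end

theory Submission
  imports Defs "HOL-Analysis.Infinite_Sum"
begin

text \<open>
  Both sides are evaluated as infinite products. Throughout, \<open>(A)_n\<close> is short for \<open>(A; Q)_n\<close>.

  Copartitions: a copartition is determined by \<open>\<gamma>\<close> and \<open>\<sigma>\<close>, and partitions into \<open>n\<close> parts from the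
  progression \<open>a, a + m, \<dots>\<close> have the generating function \<open>q^(an) / (q^m; q^m)_n\<close>. So, with \<open>Q = q^m\<close>, \<open>x = q^a\<close>
  and \<open>y = q^b\<close>, the generating function of copartitions is
  \<open>\<Sum>_(n,k) Q^(nk) x^n y^k / ((Q)_n (Q)_k)\<close> (lemma \<open>has_sum_cp\<close>). Two applications of the
  \<open>q\<close>-Chu-Vandermonde sum \<open>q_Vandermonde\<close> evaluate it: if \<open>a + b = m\<close>, that is \<open>x y = Q\<close>, the value is
  \<open>(Q)_\<infinity> / ((x)_\<infinity> (y)_\<infinity>)\<close> (lemma \<open>fps_cp_eq\<close>).

  Rogers--Ramanujan functions: this is Bressoud's argument. A case of the finite Jacobi triple product
  says that \<open>\<Sum>_j (-1)^j q^(j(j-1)/2) / ((q)_(s-j) (q)_(s+r+j))\<close> is 1 for \<open>s = 0\<close> and 0 for \<open>s > 0\<close>, where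
  \<open>r \<in> {0, 1}\<close>. Applying \<open>bailey_step\<close> twice turns this indicator into \<open>\<Sum>_s q^(s(s+r)) / ((q)_s (q)_(n-s))\<close> and
  multiplies the \<open>j\<close>-th summand by \<open>q^(2j(j+r))\<close>. As \<open>n \<rightarrow> \<infinity>\<close>, the former tends to \<open>G(q)\<close> or
  \<open>H(q)\<close> divided by \<open>(q)_\<infinity>\<close>, and the latter to a theta series divided by \<open>(q)_\<infinity>^2\<close>, which the Jacobi triple
  product in base \<open>q^5\<close> factors (lemma \<open>rogers_ramanujan_theta\<close>).

  All limits are taken in the \<open>q\<close>-adic topology by means of \<open>tannery_fps\<close>. The theorem then follows
  from \<open>(q; q)_\<infinity> = \<Prod>_r (q^r; q^5)_\<infinity>\<close>, where \<open>r\<close> runs from 1 to 5 (lemma \<open>qpoch_inf_dissection\<close>).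
\<close>

section \<open>Limits and infinite sums of formal power series\<close>

lemma tendsto_mult_fps:
  fixes f g :: "'b \<Rightarrow> 'a::ring fps"
  assumes "(f \<longlongrightarrow> a) F" "(g \<longlongrightarrow> b) F"
  shows "((\<lambda>x. f x * g x) \<longlongrightarrow> a * b) F"
proof (rule tendsto_fpsI)
  fix n
  have "\<forall>\<^sub>F x in F. \<forall>i\<le>n. f x $ i = a $ i"
    using assms(1) unfolding tendsto_fps_iff
    by (subst eventually_ball_finite_distrib[of "{..n}", unfolded Ball_def atMost_iff]) auto
  moreover have "\<forall>\<^sub>F x in F. \<forall>i\<le>n. g x $ i = b $ i"
    using assms(2) unfolding tendsto_fps_iff
    by (subst eventually_ball_finite_distrib[of "{..n}", unfolded Ball_def atMost_iff]) auto
  ultimately show "\<forall>\<^sub>F x in F. (f x * g x) $ n = (a * b) $ n"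
    by eventually_elim (simp add: fps_mult_nth)
qed

lemma has_sum_fpsI_support:
  fixes C :: "'i \<Rightarrow> 'a::ab_group_add fps"
  assumes "\<And>n. finite (B n)" "\<And>n i. i \<notin> B n \<Longrightarrow> C i $ n = 0"
    and "\<And>n. S $ n = (\<Sum>i\<in>B n. C i $ n)"
  shows "(C has_sum S) UNIV"
proof (rule has_sum_fpsI)
  fix n
  have sub: "{i \<in> UNIV. C i $ n \<noteq> 0} \<subseteq> B n"
    using assms(2) by auto
  then show "finite {i \<in> UNIV. C i $ n \<noteq> 0}"
    by (rule finite_subset) (rule assms(1))
  show "S $ n = (\<Sum>i | i \<in> UNIV \<and> C i $ n \<noteq> 0. C i $ n)"
    unfolding assms(3) by (rule sum.mono_neutral_right) (use assms(1) sub in auto)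
qed

lemma summable_on_fpsI:
  fixes C :: "'i \<Rightarrow> 'a::ab_group_add fps"
  assumes "\<And>n. finite (B n)" "\<And>n i. i \<notin> B n \<Longrightarrow> C i $ n = 0"
  shows "C summable_on UNIV"
proof -
  have "(C has_sum Abs_fps (\<lambda>n. \<Sum>i\<in>B n. C i $ n)) UNIV"
    by (rule has_sum_fpsI_support) (use assms in auto)
  then show ?thesis
    by (rule has_sum_imp_summable)
qed

text \<open>
  Tannery's theorem for formal power series. No domination hypothesis is needed, as only finitely
  many members of a summable family \<open>C\<close> contribute to any given coefficient.
\<close>

lemma tannery_fps:
  fixes C :: "'i \<Rightarrow> 'a::comm_ring_1 fps"
  assumes C: "(C has_sum S) UNIV"
    and f: "\<And>i. (\<lambda>N. f N i) \<longlonglongrightarrow> L"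
    and A: "\<And>N. finite (A N)" "\<And>i. \<forall>\<^sub>F N in sequentially. i \<in> A N"
  shows "(\<lambda>N. \<Sum>i\<in>A N. C i * f N i) \<longlonglongrightarrow> S * L"
proof (rule tendsto_fpsI)
  fix n
  define B where "B = (\<Union>k\<le>n. {i \<in> UNIV. C i $ k \<noteq> 0})"
  have fin: "finite B"
    unfolding B_def using has_sum_fpsD(1)[OF C] by blast
  have C0: "C i $ k = 0" if "i \<notin> B" "k \<le> n" for i k
    using that by (auto simp: B_def)
  have S: "S $ k = (\<Sum>i\<in>B. C i $ k)" if "k \<le> n" for k
    unfolding has_sum_fpsD(2)[OF C, of k]
    by (rule sum.mono_neutral_left) (use fin that in \<open>auto simp: B_def\<close>)
  have "\<forall>\<^sub>F N in sequentially. \<forall>i\<in>B. i \<in> A N"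
    using fin A(2) by (simp add: eventually_ball_finite)
  moreover have "\<forall>\<^sub>F N in sequentially. \<forall>i\<in>B. \<forall>k\<in>{..n}. f N i $ k = L $ k"
    using fin f unfolding tendsto_fps_iff by (simp add: eventually_ball_finite)
  ultimately show "\<forall>\<^sub>F N in sequentially. (\<Sum>i\<in>A N. C i * f N i) $ n = (S * L) $ n"
  proof eventually_elim
    case (elim N)
    have "(\<Sum>i\<in>A N. C i * f N i) $ n = (\<Sum>i\<in>A N. (C i * f N i) $ n)"
      by (simp add: fps_sum_nth)
    also have "\<dots> = (\<Sum>i\<in>B. (C i * f N i) $ n)"
      by (rule sum.mono_neutral_right) (use A elim C0 in \<open>auto simp: fps_mult_nth\<close>)
    also have "\<dots> = (\<Sum>i\<in>B. \<Sum>k\<le>n. C i $ k * L $ (n - k))"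
      using elim by (simp add: fps_mult_nth atLeast0AtMost)
    also have "\<dots> = (\<Sum>k\<le>n. (\<Sum>i\<in>B. C i $ k) * L $ (n - k))"
      by (subst sum.swap) (simp add: sum_distrib_right)
    also have "\<dots> = (S * L) $ n"
      by (simp add: fps_mult_nth atLeast0AtMost S)
    finally show ?case .
  qed
qed

section \<open>Finite \<open>q\<close>-shifted factorials\<close>

lemma qpoch_0 [simp]: "qpoch A Q 0 = 1"
  by (simp add: qpoch_def)

lemma qpoch_Suc: "qpoch A Q (Suc n) = qpoch A Q n * (1 - A * Q ^ n)"
  by (simp add: qpoch_def)

lemma qpoch_add: "qpoch A Q (m + n) = qpoch A Q m * qpoch (A * Q ^ m) Q n"
  by (induction n) (simp_all add: qpoch_Suc power_add mult.assoc)

lemma qpoch_Suc_left: "qpoch A Q (Suc n) = (1 - A) * qpoch (A * Q) Q n"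
  using qpoch_add[of A Q 1 n] by (simp add: qpoch_Suc)

text \<open>
  \<open>inv_qfact Q n\<close> is \<open>1 / (Q; Q)_n\<close>. In the lemmas below, the hypothesis \<open>Q $ 0 = 0\<close> makes the constant
  coefficient of \<open>(Q; Q)_n\<close> equal to 1, so that the inverse is a genuine one.
\<close>

definition inv_qfact :: "'a::field fps \<Rightarrow> nat \<Rightarrow> 'a fps" where
  "inv_qfact Q n = inverse (qpoch Q Q n)"

lemma qpoch_nth_0:
  fixes Q :: "'a::field fps"
  assumes "Q $ 0 = 0"
  shows "qpoch Q Q n $ 0 = 1"
  by (induction n) (simp_all add: qpoch_Suc assms)

lemma inv_qfact_0 [simp]: "inv_qfact Q 0 = 1"
  by (simp add: inv_qfact_def)

lemma qpoch_mult_inv_qfact: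
  fixes Q :: "'a::field fps"
  assumes "Q $ 0 = 0"
  shows "qpoch Q Q n * inv_qfact Q n = 1"
  using qpoch_nth_0[OF assms, of n] unfolding inv_qfact_def by (simp add: inverse_mult_eq_1')

lemma one_minus_power_neq_0:
  fixes Q :: "'a::field fps"
  assumes "Q $ 0 = 0"
  shows "1 - Q ^ Suc n \<noteq> 0"
proof -
  have "(1 - Q ^ Suc n) $ 0 = 1"
    using assms by simp
  then show ?thesis
    by (metis fps_zero_nth zero_neq_one)
qed

lemma inv_qfact_Suc:
  fixes Q :: "'a::field fps"
  assumes "Q $ 0 = 0"
  shows "(1 - Q ^ Suc n) * inv_qfact Q (Suc n) = inv_qfact Q n"
proof -
  have "qpoch Q Q n * ((1 - Q ^ Suc n) * inv_qfact Q (Suc n)) = qpoch Q Q n * inv_qfact Q n"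
    using qpoch_mult_inv_qfact[OF assms, of n] qpoch_mult_inv_qfact[OF assms, of "Suc n"]
    by (simp add: qpoch_Suc mult.assoc)
  moreover have "qpoch Q Q n \<noteq> 0"
    using qpoch_mult_inv_qfact[OF assms, of n] by auto
  ultimately show ?thesis by simp
qed

text \<open>
  The recursion behind both summation formulas of this section. It splits
  \<open>1 - Q^(N+1) = (1 - Q^n) + Q^n (1 - Q^(N+1-n))\<close> inside the sum; each of the two factors lowers the index of
  one reciprocal by 1.
\<close>

lemma q_convolution_Suc:
  fixes Q :: "'a::field fps"
  assumes Q: "Q $ 0 = 0"
  shows "(1 - Q ^ Suc N) * (\<Sum>n\<le>Suc N. inv_qfact Q n * inv_qfact Q (Suc N - n) * f n (Suc N - n)) =
    (\<Sum>n\<le>N. inv_qfact Q n * inv_qfact Q (N - n) * f (Suc n) (N - n)) +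
    (\<Sum>n\<le>N. inv_qfact Q n * inv_qfact Q (N - n) * (Q ^ n * f n (Suc (N - n))))"
proof -
  let ?t = "\<lambda>n. inv_qfact Q n * inv_qfact Q (Suc N - n) * f n (Suc N - n)"
  have "(1 - Q ^ Suc N) * (\<Sum>n\<le>Suc N. ?t n) =
      (\<Sum>n\<le>Suc N. (1 - Q ^ n) * ?t n + Q ^ n * (1 - Q ^ (Suc N - n)) * ?t n)"
  proof (unfold sum_distrib_left, rule sum.cong[OF refl])
    fix n assume "n \<in> {..Suc N}"
    then have "Q ^ Suc N = Q ^ n * Q ^ (Suc N - n)"
      by (metis atMost_iff le_add_diff_inverse power_add)
    then show "(1 - Q ^ Suc N) * ?t n = (1 - Q ^ n) * ?t n + Q ^ n * (1 - Q ^ (Suc N - n)) * ?t n"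
      by (simp only:) (simp add: algebra_simps)
  qed
  also have "\<dots> = (\<Sum>n\<le>Suc N. (1 - Q ^ n) * ?t n) + (\<Sum>n\<le>Suc N. Q ^ n * (1 - Q ^ (Suc N - n)) * ?t n)"
    by (rule sum.distrib)
  also have "(\<Sum>n\<le>Suc N. (1 - Q ^ n) * ?t n) = (\<Sum>n\<le>N. (1 - Q ^ Suc n) * ?t (Suc n))"
    by (subst sum.atMost_Suc_shift) simp
  also have "\<dots> = (\<Sum>n\<le>N. inv_qfact Q n * inv_qfact Q (N - n) * f (Suc n) (N - n))"
    by (rule sum.cong) (simp_all only: mult.assoc[symmetric] inv_qfact_Suc[OF Q] diff_Suc_Suc)
  also have "(\<Sum>n\<le>Suc N. Q ^ n * (1 - Q ^ (Suc N - n)) * ?t n) =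
      (\<Sum>n\<le>N. Q ^ n * (1 - Q ^ (Suc N - n)) * ?t n)"
    by simp
  also have "\<dots> = (\<Sum>n\<le>N. inv_qfact Q n * inv_qfact Q (N - n) * (Q ^ n * f n (Suc (N - n))))"
  proof (rule sum.cong[OF refl])
    fix n assume "n \<in> {..N}"
    then have eq: "Suc N - n = Suc (N - n)" by (simp add: Suc_diff_le)
    show "Q ^ n * (1 - Q ^ (Suc N - n)) * ?t n =
        inv_qfact Q n * inv_qfact Q (N - n) * (Q ^ n * f n (Suc (N - n)))"
      unfolding eq inv_qfact_Suc[OF Q, of "N - n", symmetric] by (simp only: mult_ac)
  qed
  finally show ?thesis .
qed

text \<open>
  The \<open>q\<close>-Chu-Vandermonde sum. It compares coefficients of \<open>z^N\<close> in
  \<open>(xyz; Q)_\<infinity> / (z; Q)_\<infinity> = (xyz; Q)_\<infinity> / (xz; Q)_\<infinity> \<cdot> (xz; Q)_\<infinity> / (z; Q)_\<infinity>\<close>, but is proved by induction on \<open>N\<close>.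
\<close>

lemma q_Vandermonde:
  fixes Q :: "'a::field fps"
  assumes Q: "Q $ 0 = 0"
  shows "(\<Sum>n\<le>N. inv_qfact Q n * inv_qfact Q (N - n) * (x ^ n * qpoch y Q n * qpoch x Q (N - n))) =
    qpoch (x * y) Q N * inv_qfact Q N"
proof (induction N arbitrary: x y)
  case 0
  then show ?case by simp
next
  case (Suc N)
  let ?T = "\<lambda>N x y. \<Sum>n\<le>N. inv_qfact Q n * inv_qfact Q (N - n) * (x ^ n * qpoch y Q n * qpoch x Q (N - n))"
  have "(1 - Q ^ Suc N) * ?T (Suc N) x y =
     x * (1 - y) * ?T N x (y * Q) + (1 - x) * ?T N (x * Q) y"
    unfolding q_convolution_Suc[OF Q, of N "\<lambda>n k. x ^ n * qpoch y Q n * qpoch x Q k"]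
    unfolding sum_distrib_left
    by (intro arg_cong2[where f = "(+)"] sum.cong refl)
      (simp_all add: qpoch_Suc_left power_mult_distrib mult_ac)
  also have "\<dots> = (1 - x * y) * qpoch (x * y * Q) Q N * inv_qfact Q N"
    unfolding Suc.IH by (simp add: algebra_simps)
  also have "\<dots> = (1 - Q ^ Suc N) * (qpoch (x * y) Q (Suc N) * inv_qfact Q (Suc N))"
    unfolding qpoch_Suc_left inv_qfact_Suc[OF Q, of N, symmetric] by (simp only: mult_ac)
  finally show ?case
    using one_minus_power_neq_0[OF Q, of N] mult_left_cancel by blast
qed

lemma q_Vandermonde_limit_exponent:
  fixes s m N :: nat
  assumes "s \<le> N"
  shows "s + ((Suc (N - s))\<^sup>2 + m * Suc (N - s)) = Suc (N + m) + ((N - s)\<^sup>2 + Suc m * (N - s))"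
proof -
  obtain t where "N = s + t"
    using assms le_Suc_ex by blast
  then show ?thesis
    by (simp add: power2_eq_square)
qed

text \<open>
  A limiting case of the \<open>q\<close>-Chu-Vandermonde sum; with \<open>t = N - s\<close> it reads
  \<open>\<Sum>_t Q^(t(t+m)) / ((Q)_(N-t) (Q)_t (Q)_(t+m)) = 1 / ((Q)_N (Q)_(N+m))\<close>.
\<close>

lemma q_Vandermonde_limit:
  fixes Q :: "'a::field fps"
  assumes Q: "Q $ 0 = 0"
  shows "(\<Sum>s\<le>N. inv_qfact Q s * inv_qfact Q (N - s) *
       (Q ^ ((N - s)\<^sup>2 + m * (N - s)) * inv_qfact Q (N - s + m))) = inv_qfact Q N * inv_qfact Q (N + m)"
proof (induction N arbitrary: m)
  case 0
  then show ?case by simp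
next
  case (Suc N)
  let ?S = "\<lambda>N m. \<Sum>s\<le>N. inv_qfact Q s * inv_qfact Q (N - s) *
       (Q ^ ((N - s)\<^sup>2 + m * (N - s)) * inv_qfact Q (N - s + m))"
  have "(1 - Q ^ Suc N) * ?S (Suc N) m = ?S N m + Q ^ Suc (N + m) * ?S N (Suc m)"
    unfolding q_convolution_Suc[OF Q, of N "\<lambda>s t. Q ^ (t\<^sup>2 + m * t) * inv_qfact Q (t + m)"]
    unfolding sum_distrib_left
  proof (intro arg_cong2[where f = "(+)"] sum.cong refl)
    fix s assume "s \<in> {..N}"
    then have power: "Q ^ s * Q ^ ((Suc (N - s))\<^sup>2 + m * Suc (N - s)) =
        Q ^ Suc (N + m) * Q ^ ((N - s)\<^sup>2 + Suc m * (N - s))"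
      by (simp only: power_add[symmetric] atMost_iff q_Vandermonde_limit_exponent)
    have "inv_qfact Q s * inv_qfact Q (N - s) *
        (Q ^ s * (Q ^ ((Suc (N - s))\<^sup>2 + m * Suc (N - s)) * inv_qfact Q (Suc (N - s) + m))) =
      (Q ^ s * Q ^ ((Suc (N - s))\<^sup>2 + m * Suc (N - s))) *
        (inv_qfact Q s * inv_qfact Q (N - s) * inv_qfact Q (Suc (N - s) + m))"
      by (simp only: mult_ac)
    also have "\<dots> = Q ^ Suc (N + m) * (inv_qfact Q s * inv_qfact Q (N - s) *
        (Q ^ ((N - s)\<^sup>2 + Suc m * (N - s)) * inv_qfact Q (N - s + Suc m)))"
      unfolding power by (simp only: mult_ac add_Suc add_Suc_right)
    finally show "inv_qfact Q s * inv_qfact Q (N - s) *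
        (Q ^ s * (Q ^ ((Suc (N - s))\<^sup>2 + m * Suc (N - s)) * inv_qfact Q (Suc (N - s) + m))) =
      Q ^ Suc (N + m) * (inv_qfact Q s * inv_qfact Q (N - s) *
        (Q ^ ((N - s)\<^sup>2 + Suc m * (N - s)) * inv_qfact Q (N - s + Suc m)))" .
  qed
  also have "\<dots> = inv_qfact Q N * inv_qfact Q (Suc (N + m))"
  proof -
    have ring: "a * ((1 - c) * b) + c * (a * b) = a * b" for a b c :: "'a fps"
      by (simp add: algebra_simps)
    have Suc_m: "N + Suc m = Suc (N + m)"
      by simp
    show ?thesis
      unfolding Suc.IH Suc_m inv_qfact_Suc[OF Q, of "N + m", symmetric] by (rule ring)
  qed
  also have "\<dots> = (1 - Q ^ Suc N) * (inv_qfact Q (Suc N) * inv_qfact Q (Suc N + m))"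
    unfolding inv_qfact_Suc[OF Q, of N, symmetric] by (simp only: mult_ac add_Suc)
  finally show ?case
    unfolding mult_left_cancel[OF one_minus_power_neq_0[OF Q]] .
qed

section \<open>The finite Jacobi triple product\<close>

text \<open>
  The extension of \<open>inv_qfact\<close> to integer indices by 0. With this convention the recursion
  \<open>inv_qfact_int_rec\<close> holds for every integer \<open>i\<close> (for \<open>i \<le> 0\<close> both sides vanish, as \<open>nat i = 0\<close>), and
  bilateral sums terminate by themselves.
\<close>

definition inv_qfact_int :: "'a::field fps \<Rightarrow> int \<Rightarrow> 'a fps" where
  "inv_qfact_int Q i = (if i < 0 then 0 else inv_qfact Q (nat i))"

lemma inv_qfact_int_neg [simp]: "i < 0 \<Longrightarrow> inv_qfact_int Q i = 0"
  by (simp add: inv_qfact_int_def)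

lemma inv_qfact_int_of_nat [simp]: "inv_qfact_int Q (int n) = inv_qfact Q n"
  by (simp add: inv_qfact_int_def)

lemma inv_qfact_int_rec:
  fixes Q :: "'a::field fps"
  assumes Q: "Q $ 0 = 0"
  shows "(1 - Q ^ nat i) * inv_qfact_int Q i = inv_qfact_int Q (i - 1)"
proof (cases "i > 0")
  case True
  then obtain n where "i = int (Suc n)"
    by (metis gr0_implies_Suc zero_less_imp_eq_int)
  then have i: "nat i = Suc n" "i = int (Suc n)" "i - 1 = int n"
    by simp_all
  show ?thesis
    unfolding i(3) i(1) unfolding i(2) inv_qfact_int_of_nat by (rule inv_qfact_Suc[OF Q])
next
  case False
  then show ?thesis
    by (cases "i = 0") (simp_all add: inv_qfact_int_def)
qed

text \<open>
  The term \<open>(-1)^j x^j Q^(j(j-1)/2)\<close> of the theta series, for any integer \<open>j\<close>. Negative powers of \<open>x\<close> are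
  avoided by a second parameter \<open>y\<close>, to be thought of as \<open>Q / x\<close>: for \<open>j = -i\<close> the term equals
  \<open>(-1)^i (Q / x)^i Q^(i(i-1)/2)\<close>.
\<close>

definition jtp_coeff :: "'a::comm_ring_1 \<Rightarrow> 'a \<Rightarrow> 'a \<Rightarrow> int \<Rightarrow> 'a" where
  "jtp_coeff x y Q j = (if j \<ge> 0 then (-1) ^ nat j * x ^ nat j * Q ^ (nat j choose 2)
     else (-1) ^ nat (-j) * y ^ nat (-j) * Q ^ (nat (-j) choose 2))"

lemma jtp_coeff_of_nat: "jtp_coeff x y Q (int i) = (-1) ^ i * x ^ i * Q ^ (i choose 2)"
  by (simp add: jtp_coeff_def)

lemma jtp_coeff_uminus: "jtp_coeff x y Q (- j) = jtp_coeff y x Q j"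
  by (auto simp: jtp_coeff_def)

lemma jtp_coeff_minus_of_nat: "jtp_coeff x y Q (- int i) = (-1) ^ i * y ^ i * Q ^ (i choose 2)"
  unfolding jtp_coeff_uminus by (rule jtp_coeff_of_nat)

lemma Suc_choose_2: "Suc i choose 2 = i + (i choose 2)"
  by (simp add: numeral_2_eq_2)

lemma square_eq_choose_2: "i * i = i + 2 * (i choose 2)" for i :: nat
  by (induction i) (simp_all add: Suc_choose_2 binomial_eq_0)

lemma jtp_coeff_shift:
  assumes xy: "x * y = Q" and j: "j \<le> int M + 1"
  shows "jtp_coeff x y Q j * Q ^ nat (int M + 1 - j) = - x * Q ^ M * jtp_coeff x y Q (j - 1)"
proof (cases "j > 0")
  case True
  then obtain i where i: "j = int (Suc i)"
    by (metis gr0_implies_Suc zero_less_imp_eq_int)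
  with j have "i \<le> M" by simp
  then obtain k where k: "M = i + k"
    using le_Suc_ex by blast
  have "nat (int M + 1 - j) = k" "j - 1 = int i"
    by (simp_all add: i k)
  then show ?thesis
    by (simp only: i jtp_coeff_of_nat Suc_choose_2 k) (simp add: power_add mult_ac)
next
  case False
  then have "j \<le> 0" by simp
  then obtain i where i: "j = - int i"
    by (rule nonpos_int_cases)
  have "nat (int M + 1 - j) = Suc M + i" "j - 1 = - int (Suc i)"
    by (simp_all add: i)
  then have "jtp_coeff x y Q j * Q ^ nat (int M + 1 - j) =
      (-1) ^ i * y ^ i * Q ^ (i choose 2) * (Q * Q ^ M * Q ^ i)"
    "jtp_coeff x y Q (j - 1) = - ((-1) ^ i * (y * y ^ i) * (Q ^ i * Q ^ (i choose 2)))"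
    by (simp_all only: i jtp_coeff_minus_of_nat Suc_choose_2) (simp_all add: power_add mult_ac)
  then show ?thesis
    by (simp add: xy[symmetric] mult_ac)
qed

lemma jtp_sum_extend:
  assumes "finite J" "{- int N..int M} \<subseteq> J"
  shows "(\<Sum>j\<in>J. C j * (inv_qfact_int Q (int M - j) * inv_qfact_int Q (int N + j))) =
    (\<Sum>j = - int N..int M. C j * (inv_qfact_int Q (int M - j) * inv_qfact_int Q (int N + j)))"
proof (rule sum.mono_neutral_right[OF assms], rule ballI)
  fix j assume "j \<in> J - {- int N..int M}"
  then have "int M - j < 0 \<or> int N + j < 0" by auto
  then show "C j * (inv_qfact_int Q (int M - j) * inv_qfact_int Q (int N + j)) = 0" by auto
qed

text \<open>
  The sum side of the finite Jacobi triple product, divided by \<open>(Q; Q)_(M+N)\<close> so that the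
  \<open>q\<close>-binomial coefficients become products of two reciprocals.
\<close>

definition jtp_sum :: "'a::field fps \<Rightarrow> 'a fps \<Rightarrow> 'a fps \<Rightarrow> nat \<Rightarrow> nat \<Rightarrow> 'a fps" where
  "jtp_sum x y Q M N =
     (\<Sum>j = - int N..int M. jtp_coeff x y Q j * (inv_qfact_int Q (int M - j) * inv_qfact_int Q (int N + j)))"

lemma jtp_sum_commute: "jtp_sum x y Q M N = jtp_sum y x Q N M"
  unfolding jtp_sum_def
  by (rule sum.reindex_bij_witness[of _ uminus uminus]) (auto simp: jtp_coeff_uminus mult_ac)

text \<open>
  The \<open>q\<close>-Pascal rule, summed over \<open>j\<close>: the second of the two sums it produces is \<open>-x Q^M\<close> times the
  first one with \<open>j\<close> shifted by 1.
\<close>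

lemma jtp_sum_Suc:
  fixes Q :: "'a::field fps"
  assumes Q: "Q $ 0 = 0" and xy: "x * y = Q"
  shows "(1 - Q ^ Suc (M + N)) * jtp_sum x y Q (Suc M) N = (1 - x * Q ^ M) * jtp_sum x y Q M N"
proof -
  let ?b = "inv_qfact_int Q" and ?c = "jtp_coeff x y Q"
  let ?J = "{- int N..int (Suc M)}"
  have "(1 - Q ^ Suc (M + N)) * jtp_sum x y Q (Suc M) N =
      (\<Sum>j\<in>?J. ?c j * (?b (int M - j) * ?b (int N + j)) +
        (- x * Q ^ M) * (?c (j - 1) * (?b (int M - (j - 1)) * ?b (int N + (j - 1)))))"
    unfolding jtp_sum_def sum_distrib_left
  proof (rule sum.cong[OF refl])
    fix j assume j: "j \<in> ?J"
    define A B where "A = nat (int M + 1 - j)" and "B = nat (int N + j)"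
    have AB: "Suc (M + N) = A + B"
      using j unfolding A_def B_def by auto
    have b1: "?b (int M - j) = (1 - Q ^ A) * ?b (int (Suc M) - j)"
      using inv_qfact_int_rec[OF Q, of "int (Suc M) - j"]
      by (simp add: A_def algebra_simps)
    have b2: "?b (int N + (j - 1)) = (1 - Q ^ B) * ?b (int N + j)"
      using inv_qfact_int_rec[OF Q, of "int N + j"] by (simp add: B_def algebra_simps)
    have b3: "?b (int M - (j - 1)) = ?b (int (Suc M) - j)"
      by (rule arg_cong[where f = ?b]) simp
    have c: "(- x * Q ^ M) * (?c (j - 1) * t) = ?c j * Q ^ A * t" for t
      using jtp_coeff_shift[OF xy, of j M] j by (simp add: A_def mult.assoc)
    show "(1 - Q ^ Suc (M + N)) * (?c j * (?b (int (Suc M) - j) * ?b (int N + j))) =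
        ?c j * (?b (int M - j) * ?b (int N + j)) +
        (- x * Q ^ M) * (?c (j - 1) * (?b (int M - (j - 1)) * ?b (int N + (j - 1))))"
      unfolding c b1 b2 b3 AB power_add by (simp add: algebra_simps)
  qed
  also have "\<dots> = (\<Sum>j\<in>?J. ?c j * (?b (int M - j) * ?b (int N + j))) +
      (- x * Q ^ M) * (\<Sum>j\<in>?J. ?c (j - 1) * (?b (int M - (j - 1)) * ?b (int N + (j - 1))))"
    by (simp only: sum.distrib sum_distrib_left)
  also have "(\<Sum>j\<in>?J. ?c j * (?b (int M - j) * ?b (int N + j))) = jtp_sum x y Q M N"
    unfolding jtp_sum_def by (rule jtp_sum_extend) auto
  also have "(\<Sum>j\<in>?J. ?c (j - 1) * (?b (int M - (j - 1)) * ?b (int N + (j - 1)))) =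
      (\<Sum>j\<in>{- int N - 1..int M}. ?c j * (?b (int M - j) * ?b (int N + j)))"
    by (rule sum.reindex_bij_witness[of _ "\<lambda>j. j + 1" "\<lambda>j. j - 1"]) auto
  also have "\<dots> = jtp_sum x y Q M N"
    unfolding jtp_sum_def by (rule jtp_sum_extend) auto
  finally show ?thesis
    by (simp add: algebra_simps)
qed

lemma finite_jacobi_triple_product:
  fixes Q :: "'a::field fps"
  assumes Q: "Q $ 0 = 0" and xy: "x * y = Q"
  shows "jtp_sum x y Q M N = qpoch x Q M * qpoch y Q N * inv_qfact Q (M + N)"
proof -
  have step: "jtp_sum x y Q (M + k) N = qpoch x Q (M + k) * qpoch y Q N * inv_qfact Q (M + k + N)"
    if "x * y = Q" "jtp_sum x y Q M N = qpoch x Q M * qpoch y Q N * inv_qfact Q (M + N)"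
    for x y M N k
  proof (induction k)
    case 0
    then show ?case using that by simp
  next
    case (Suc k)
    have "(1 - Q ^ Suc (M + k + N)) * jtp_sum x y Q (M + Suc k) N =
        (1 - x * Q ^ (M + k)) * (qpoch x Q (M + k) * qpoch y Q N * inv_qfact Q (M + k + N))"
      unfolding Suc.IH[symmetric] add_Suc_right by (rule jtp_sum_Suc[OF Q that(1)])
    also have "\<dots> = (1 - Q ^ Suc (M + k + N)) *
        (qpoch x Q (M + Suc k) * qpoch y Q N * inv_qfact Q (M + Suc k + N))"
      unfolding inv_qfact_Suc[OF Q, of "M + k + N", symmetric] add_Suc_right add_Suc qpoch_Suc
      by (simp only: mult_ac)
    finally show ?case
      unfolding mult_left_cancel[OF one_minus_power_neq_0[OF Q]] .
  qed
  \<comment> \<open>raise \<open>N\<close> from 0 with the roles of \<open>x\<close> and \<open>y\<close> exchanged, then \<open>M\<close>\<close>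
  have "jtp_sum y x Q 0 0 = 1"
    by (simp add: jtp_sum_def jtp_coeff_def inv_qfact_int_def binomial_eq_0)
  then have "jtp_sum y x Q N 0 = qpoch y Q N * inv_qfact Q N"
    using step[of y x 0 0 N] xy by (simp add: mult.commute)
  then have "jtp_sum x y Q 0 N = qpoch y Q N * inv_qfact Q N"
    by (simp only: jtp_sum_commute)
  then show ?thesis
    using step[OF xy, of 0 N M] by simp
qed

section \<open>Bressoud's argument\<close>

text \<open>
  Conjugation of the kernel \<open>1 / ((Q)_(s-j) (Q)_(s+r+j))\<close>. The kernel and the exponent \<open>j (j + r)\<close> are invariant
  under \<open>j \<mapsto> -r-j\<close>, and as \<open>r \<le> 1\<close> one of \<open>j\<close> and \<open>-r-j\<close> is nonnegative; for \<open>j \<ge> 0\<close> the substitution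
  \<open>s = j + t\<close> leads to \<open>q_Vandermonde_limit\<close> with \<open>m = 2 j + r\<close>.
\<close>

lemma bailey_kernel:
  fixes Q :: "'a::field fps" and j :: int and r :: nat
  assumes Q: "Q $ 0 = 0" and r: "r \<le> 1"
  shows "(\<Sum>s\<le>n. Q ^ (s\<^sup>2 + r * s) * inv_qfact Q (n - s) *
      (inv_qfact_int Q (int s - j) * inv_qfact_int Q (int (s + r) + j))) =
    Q ^ nat (j\<^sup>2 + int r * j) * (inv_qfact_int Q (int n - j) * inv_qfact_int Q (int (n + r) + j))"
proof -
  let ?b = "inv_qfact_int Q" and ?u = "inv_qfact Q"
  have nonneg: "(\<Sum>s\<le>n. Q ^ (s\<^sup>2 + r * s) * ?u (n - s) * (?b (int s - int i) * ?b (int (s + r) + int i))) =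
    Q ^ (i\<^sup>2 + r * i) * (?b (int n - int i) * ?b (int (n + r) + int i))" for i
  proof (cases "i \<le> n")
    case False
    then have "(\<Sum>s\<le>n. Q ^ (s\<^sup>2 + r * s) * ?u (n - s) * (?b (int s - int i) * ?b (int (s + r) + int i))) = 0"
      by (intro sum.neutral) simp
    with False show ?thesis by simp
  next
    case True
    then obtain N where N: "n = i + N"
      using le_Suc_ex by blast
    have "(\<Sum>s\<le>n. Q ^ (s\<^sup>2 + r * s) * ?u (n - s) * (?b (int s - int i) * ?b (int (s + r) + int i))) =
        (\<Sum>s\<in>{i..n}. Q ^ (s\<^sup>2 + r * s) * ?u (n - s) * (?b (int s - int i) * ?b (int (s + r) + int i)))"
      by (rule sum.mono_neutral_right) auto
    also have "\<dots> = (\<Sum>s\<le>N. Q ^ (i\<^sup>2 + r * i) * (?u s * ?u (N - s) *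
       (Q ^ ((N - s)\<^sup>2 + (2 * i + r) * (N - s)) * ?u (N - s + (2 * i + r)))))"
    proof (rule sum.reindex_bij_witness[of _ "\<lambda>s. n - s" "\<lambda>s. n - s"])
      fix s assume "s \<in> {i..n}"
      then obtain t where t: "s = i + t" "t \<le> N"
        unfolding N by (metis atLeastAtMost_iff le_Suc_ex nat_add_left_cancel_le)
      have eqs: "n - s = N - t" "N - (N - t) = t" "int s - int i = int t"
        "int (s + r) + int i = int (t + (2 * i + r))"
        using t by (auto simp: N)
      have "Q ^ (s\<^sup>2 + r * s) = Q ^ (i\<^sup>2 + r * i) * Q ^ (t\<^sup>2 + (2 * i + r) * t)"
        unfolding power_add[symmetric] t(1)
        by (rule arg_cong[where f = "power Q"]) (simp add: power2_eq_square algebra_simps)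
      then show "Q ^ (i\<^sup>2 + r * i) * (?u (n - s) * ?u (N - (n - s)) *
         (Q ^ ((N - (n - s))\<^sup>2 + (2 * i + r) * (N - (n - s))) * ?u (N - (n - s) + (2 * i + r)))) =
        Q ^ (s\<^sup>2 + r * s) * ?u (n - s) * (?b (int s - int i) * ?b (int (s + r) + int i))"
        unfolding eqs inv_qfact_int_of_nat by (simp only: mult_ac)
    qed (auto simp: N)
    also have "\<dots> = Q ^ (i\<^sup>2 + r * i) * (?u N * ?u (N + (2 * i + r)))"
      unfolding sum_distrib_left[symmetric] q_Vandermonde_limit[OF Q] ..
    also have "?u N = ?b (int n - int i)"
      by (simp add: N)
    also have "?u (N + (2 * i + r)) = ?b (int (n + r) + int i)"
      unfolding inv_qfact_int_of_nat[symmetric] by (rule arg_cong[where f = ?b]) (simp add: N)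
    finally show ?thesis .
  qed
  show ?thesis
  proof (cases "j \<ge> 0")
    case True
    then obtain i where j: "j = int i"
      using nonneg_int_cases by blast
    have "nat (j\<^sup>2 + int r * j) = i\<^sup>2 + r * i"
      unfolding j by (simp add: nat_add_distrib nat_mult_distrib nat_power_eq)
    then show ?thesis
      using nonneg[of i] by (simp add: j)
  next
    case False
    then have "- int r - j \<ge> 0" using r by simp
    then obtain i where i: "- int r - j = int i"
      using nonneg_int_cases by blast
    then have j: "j = - int i - int r" by simp
    have "j\<^sup>2 + int r * j = int (i\<^sup>2 + r * i)"
      unfolding j by (simp add: power2_eq_square algebra_simps)
    then have "nat (j\<^sup>2 + int r * j) = i\<^sup>2 + r * i"
      by (simp only: nat_int)
    moreover have "int s - j = int (s + r) + int i" "int (s + r) + j = int s - int i" for s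
      by (simp_all add: j)
    ultimately show ?thesis
      using nonneg[of i] by (simp only: mult.commute[of "?b (_ + _)"])
  qed
qed

text \<open>
  One step along the Bailey chain: multiplying \<open>\<alpha> j\<close> by \<open>Q^(j(j+r))\<close> corresponds to a convolution of \<open>\<beta>\<close>.
\<close>

lemma bailey_step:
  fixes Q :: "'a::field fps"
  assumes Q: "Q $ 0 = 0" and r: "r \<le> 1"
    and \<beta>: "\<And>s. s \<le> n \<Longrightarrow>
      \<beta> s = (\<Sum>j\<in>J. \<alpha> j * (inv_qfact_int Q (int s - j) * inv_qfact_int Q (int (s + r) + j)))"
  shows "(\<Sum>s\<le>n. Q ^ (s\<^sup>2 + r * s) * inv_qfact Q (n - s) * \<beta> s) =
    (\<Sum>j\<in>J. \<alpha> j * Q ^ nat (j\<^sup>2 + int r * j) *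
      (inv_qfact_int Q (int n - j) * inv_qfact_int Q (int (n + r) + j)))"
proof -
  let ?b = "inv_qfact_int Q"
  have "(\<Sum>s\<le>n. Q ^ (s\<^sup>2 + r * s) * inv_qfact Q (n - s) * \<beta> s) =
      (\<Sum>s\<le>n. \<Sum>j\<in>J. \<alpha> j * (Q ^ (s\<^sup>2 + r * s) * inv_qfact Q (n - s) * (?b (int s - j) * ?b (int (s + r) + j))))"
    by (simp add: \<beta> sum_distrib_left mult_ac)
  also have "\<dots> = (\<Sum>j\<in>J. \<alpha> j * (\<Sum>s\<le>n. Q ^ (s\<^sup>2 + r * s) * inv_qfact Q (n - s) * (?b (int s - j) * ?b (int (s + r) + j))))"
    by (subst sum.swap) (simp only: sum_distrib_left)
  finally show ?thesis
    unfolding bailey_kernel[OF Q r] by (simp only: mult.assoc)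
qed

text \<open>
  A finite form of both Rogers--Ramanujan identities (\<open>r = 0\<close> and \<open>r = 1\<close>).
\<close>

lemma finite_rogers_ramanujan:
  fixes Q :: "'a::field fps"
  assumes Q: "Q $ 0 = 0" and r: "r \<le> 1"
  shows "(\<Sum>s\<le>n. Q ^ (s\<^sup>2 + r * s) * inv_qfact Q s * inv_qfact Q (n - s)) =
    (\<Sum>j = - int (n + r)..int n. jtp_coeff 1 Q Q j * Q ^ (2 * nat (j\<^sup>2 + int r * j)) *
      (inv_qfact_int Q (int n - j) * inv_qfact_int Q (int (n + r) + j)))"
proof -
  let ?J = "{- int (n + r)..int n}" and ?b = "inv_qfact_int Q"
  \<comment> \<open>the unit Bailey pair: as \<open>x = 1\<close>, the factor \<open>1 - x\<close> annihilates the triple product unless \<open>s = 0\<close>\<close>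
  have unit: "(if s = 0 then 1 else 0) =
      (\<Sum>j\<in>?J. jtp_coeff 1 Q Q j * (?b (int s - j) * ?b (int (s + r) + j)))" if "s \<le> n" for s
  proof -
    have "(\<Sum>j\<in>?J. jtp_coeff 1 Q Q j * (?b (int s - j) * ?b (int (s + r) + j))) = jtp_sum 1 Q Q s (s + r)"
      unfolding jtp_sum_def by (rule jtp_sum_extend) (use that in auto)
    also have "\<dots> = qpoch 1 Q s * qpoch Q Q (s + r) * inv_qfact Q (s + (s + r))"
      by (rule finite_jacobi_triple_product) (use Q in auto)
    also have "\<dots> = (if s = 0 then 1 else 0)"
      by (cases s) (simp_all add: qpoch_Suc_left qpoch_mult_inv_qfact[OF Q])
    finally show ?thesis ..
  qed
  \<comment> \<open>a first step along the Bailey chain; a second one follows below\<close>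
  have first: "inv_qfact Q m = (\<Sum>j\<in>?J. jtp_coeff 1 Q Q j * Q ^ nat (j\<^sup>2 + int r * j) *
      (?b (int m - j) * ?b (int (m + r) + j)))" if "m \<le> n" for m
  proof -
    have "inv_qfact Q m = (\<Sum>s\<le>m. Q ^ (s\<^sup>2 + r * s) * inv_qfact Q (m - s) * (if s = 0 then 1 else 0))"
      by (simp add: mult_delta_right)
    also have "\<dots> = (\<Sum>j\<in>?J. jtp_coeff 1 Q Q j * Q ^ nat (j\<^sup>2 + int r * j) *
      (?b (int m - j) * ?b (int (m + r) + j)))"
      by (rule bailey_step[OF Q r]) (use unit that in auto)
    finally show ?thesis .
  qed
  have "(\<Sum>s\<le>n. Q ^ (s\<^sup>2 + r * s) * inv_qfact Q s * inv_qfact Q (n - s)) =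
      (\<Sum>s\<le>n. Q ^ (s\<^sup>2 + r * s) * inv_qfact Q (n - s) * inv_qfact Q s)"
    by (simp only: mult_ac)
  also have "\<dots> = (\<Sum>j\<in>?J. (jtp_coeff 1 Q Q j * Q ^ nat (j\<^sup>2 + int r * j)) * Q ^ nat (j\<^sup>2 + int r * j) *
      (?b (int n - j) * ?b (int (n + r) + j)))"
    by (rule bailey_step[OF Q r]) (rule first)
  finally show ?thesis
    by (simp only: mult.assoc power_add[symmetric] mult_2)
qed

section \<open>The generating function of copartitions\<close>

text \<open>
  For \<open>a > 0\<close>, the partitions of \<open>s\<close> into exactly \<open>n\<close> parts taken from \<open>a, a + m, a + 2 m, \<dots>\<close>.
\<close>

definition ap_partitions :: "nat \<Rightarrow> nat \<Rightarrow> nat \<Rightarrow> nat \<Rightarrow> nat multiset set" where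
  "ap_partitions a m n s =
     {P. size P = n \<and> (\<forall>x\<in>#P. a \<le> x \<and> [x = a] (mod m)) \<and> sum_mset P = s}"

lemma finite_ap_partitions:
  assumes "a > 0"
  shows "finite (ap_partitions a m n s)"
  by (rule finite_subset[OF _ finite_partitions_bounded[of s]])
    (use assms in \<open>auto simp: ap_partitions_def is_partition_def\<close>)

lemma ap_partitions_0: "ap_partitions a m 0 s = (if s = 0 then {{#}} else {})"
  by (auto simp: ap_partitions_def)

lemma ap_partitions_eq_empty:
  assumes "s < a"
  shows "ap_partitions a m (Suc n) s = {}"
proof -
  have False if P: "P \<in> ap_partitions a m (Suc n) s" for P
  proof -
    obtain x where x: "x \<in># P"
      using P by (auto simp: ap_partitions_def dest!: size_eq_Suc_imp_elem)
    then have "a \<le> x" "x \<le> sum_mset P"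
      using P multi_member_split[OF x] by (auto simp: ap_partitions_def)
    with P assms show False by (simp add: ap_partitions_def)
  qed
  then show ?thesis by blast
qed

lemma next_in_progression_iff:
  fixes a m x :: nat
  assumes "m > 0"
  shows "a \<le> x \<and> [x = a] (mod m) \<longleftrightarrow> x = a \<or> a + m \<le> x \<and> [x = a + m] (mod m)"
proof -
  have eq: "[x = a + m] (mod m) \<longleftrightarrow> [x = a] (mod m)"
    by (simp add: cong_def)
  have "a + m \<le> x" if "a \<le> x" "[x = a] (mod m)" "x \<noteq> a"
  proof -
    have "m dvd x - a" "x - a > 0"
      using that by (simp_all add: cong_altdef_nat)
    then have "m \<le> x - a" by (rule dvd_imp_le)
    with that show ?thesis by simp
  qed
  then show ?thesis unfolding eq by auto
qed

text \<open>
  Either \<open>a\<close> is a part and can be removed, or all parts lie in the progression that starts at \<open>a + m\<close>.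
\<close>

lemma ap_partitions_Suc:
  assumes m: "m > 0" and a: "a \<le> s"
  shows "ap_partitions a m (Suc n) s =
    add_mset a ` ap_partitions a m n (s - a) \<union> ap_partitions (a + m) m (Suc n) s"
    (is "?L = ?R")
proof (intro set_eqI iffI)
  fix P assume P: "P \<in> ?L"
  show "P \<in> ?R"
  proof (cases "a \<in># P")
    case True
    then obtain P' where "P = add_mset a P'"
      using multi_member_split by metis
    with P show ?thesis by (auto simp: ap_partitions_def)
  next
    case False
    have "a + m \<le> x \<and> [x = a + m] (mod m)" if "x \<in># P" for x
      using P that False next_in_progression_iff[OF m, of a x] unfolding ap_partitions_def by auto
    with P show ?thesis by (auto simp: ap_partitions_def)
  qed
next
  fix P assume "P \<in> ?R"
  then show "P \<in> ?L"
    using a next_in_progression_iff[OF m, of a] unfolding ap_partitions_def by auto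
qed

lemma card_ap_partitions_Suc:
  assumes m: "m > 0" and a: "a > 0" "a \<le> s"
  shows "card (ap_partitions a m (Suc n) s) =
    card (ap_partitions a m n (s - a)) + card (ap_partitions (a + m) m (Suc n) s)"
proof -
  have "add_mset a ` ap_partitions a m n (s - a) \<inter> ap_partitions (a + m) m (Suc n) s = {}"
  proof -
    have "a \<notin># P" if "P \<in> ap_partitions (a + m) m (Suc n) s" for P
      using that m unfolding ap_partitions_def by fastforce
    then show ?thesis
      by fastforce
  qed
  then have "card (ap_partitions a m (Suc n) s) =
      card (add_mset a ` ap_partitions a m n (s - a)) + card (ap_partitions (a + m) m (Suc n) s)"
    unfolding ap_partitions_Suc[OF m a(2)]
    by (intro card_Un_disjoint finite_imageI finite_ap_partitions) (use a in simp_all)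
  also have "card (add_mset a ` ap_partitions a m n (s - a)) = card (ap_partitions a m n (s - a))"
    by (rule card_image) (rule inj_onI, simp)
  finally show ?thesis .
qed

text \<open>
  For a fixed number \<open>n\<close> of parts, the generating function is \<open>q^(an) / (q^m; q^m)_n\<close>. Both sides satisfy the
  recursion \<open>F(a, n + 1) = q^a F(a, n) + F(a + m, n + 1)\<close>, and both have coefficient 0 at \<open>q^s\<close> once \<open>a > s\<close>
  and there is at least one part; hence the inner induction, on \<open>s + 1 - a\<close>.
\<close>

lemma fps_of_ap_partitions:
  fixes m :: nat
  assumes m: "m > 0" and a: "a > 0"
  shows "of_nat (card (ap_partitions a m n s)) =
    ((fps_X ^ a) ^ n * inv_qfact (fps_X ^ m :: 'a::field_char_0 fps) n) $ s"
  using a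
proof (induction n arbitrary: a s)
  case 0
  then show ?case by (simp add: ap_partitions_0)
next
  case (Suc n)
  let ?Q = "fps_X ^ m :: 'a fps"
  let ?F = "\<lambda>a n. (fps_X ^ a) ^ n * inv_qfact ?Q n"
  have Q: "?Q $ 0 = 0"
    using m by simp
  have rec: "?F a (Suc n) = fps_X ^ a * ?F a n + ?F (a + m) (Suc n)" for a
  proof -
    have "?F (a + m) (Suc n) = (fps_X ^ a) ^ Suc n * (?Q ^ Suc n * inv_qfact ?Q (Suc n))"
      by (simp only: power_add power_mult_distrib mult.assoc)
    moreover have "fps_X ^ a * ?F a n = (fps_X ^ a) ^ Suc n * ((1 - ?Q ^ Suc n) * inv_qfact ?Q (Suc n))"
      unfolding inv_qfact_Suc[OF Q, of n] by (simp only: power_Suc mult.assoc)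
    ultimately show ?thesis
      by (simp only: distrib_left[symmetric] distrib_right[symmetric]) simp
  qed
  show ?case
    using \<open>a > 0\<close>
  proof (induction "Suc s - a" arbitrary: a rule: less_induct)
    case (less a)
    show ?case
    proof (cases "s < a")
      case True
      have "?F a (Suc n) = fps_X ^ a * ((fps_X ^ a) ^ n * inv_qfact ?Q (Suc n))"
        by (simp only: power_Suc mult.assoc)
      with True show ?thesis
        by (simp only: fps_X_power_mult_nth ap_partitions_eq_empty) simp
    next
      case False
      have "of_nat (card (ap_partitions (a + m) m (Suc n) s)) = ?F (a + m) (Suc n) $ s"
        by (rule less.hyps) (use False m less.prems in auto)
      moreover have "of_nat (card (ap_partitions a m n (s - a))) = ?F a n $ (s - a)"
        by (rule Suc.IH) (rule less.prems)
      moreover have "?F a (Suc n) $ s = ?F a n $ (s - a) + ?F (a + m) (Suc n) $ s"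
        unfolding rec[of a] using False by (simp only: fps_add_nth fps_X_power_mult_nth if_False)
      ultimately show ?thesis
        using False less.prems by (simp only: card_ap_partitions_Suc[OF m] not_less of_nat_add)
    qed
  qed
qed

text \<open>
  The component \<open>\<rho>\<close> of a copartition is determined by the other two components. Whether or not \<open>\<gamma>\<close> is
  empty, its size is \<open>m\<close> times the product of the numbers of parts of \<open>\<gamma>\<close> and \<open>\<sigma>\<close>.
\<close>

definition rho_part :: "nat \<Rightarrow> nat multiset \<Rightarrow> nat multiset \<Rightarrow> nat multiset" where
  "rho_part m \<gamma> \<sigma> = (if \<gamma> = {#} then {#} else replicate_mset (size \<sigma>) (m * size \<gamma>))"

lemma sum_mset_rho_part: "sum_mset (rho_part m \<gamma> \<sigma>) = m * size \<gamma> * size \<sigma>"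
  by (simp add: rho_part_def)

lemma is_partition_rho_part:
  assumes "m > 0"
  shows "is_partition (rho_part m \<gamma> \<sigma>)"
proof (cases "\<gamma> = {#}")
  case False
  then have "size \<gamma> > 0"
    by (simp add: nonempty_has_size)
  with assms show ?thesis
    by (simp add: is_partition_def rho_part_def)
qed (simp add: is_partition_def rho_part_def)

lemma eq_rho_part_iff:
  "\<rho> = rho_part m \<gamma> \<sigma> \<longleftrightarrow>
     (if \<gamma> = {#} then \<rho> = {#} else size \<rho> = size \<sigma> \<and> (\<forall>x\<in>#\<rho>. x = m * size \<gamma>))"
proof (cases "\<gamma> = {#}")
  case False
  have "\<rho> = replicate_mset k c \<longleftrightarrow> size \<rho> = k \<and> (\<forall>x\<in>#\<rho>. x = c)" for k c
  proof
    assume "size \<rho> = k \<and> (\<forall>x\<in>#\<rho>. x = c)"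
    then have "set_mset \<rho> \<subseteq> {c}" "size \<rho> = k" by auto
    then show "\<rho> = replicate_mset k c"
      using set_mset_subset_singletonD[of \<rho> c] by simp
  qed (simp split: if_splits)
  then show ?thesis
    unfolding rho_part_def if_not_P[OF False] .
qed (simp add: rho_part_def)

lemma copartition_iff:
  assumes "a > 0" "b > 0" "m > 0"
  shows "copartition a b m (\<gamma>, \<rho>, \<sigma>) \<longleftrightarrow>
    (\<forall>x\<in>#\<gamma>. a \<le> x \<and> [x = a] (mod m)) \<and> (\<forall>x\<in>#\<sigma>. b \<le> x \<and> [x = b] (mod m)) \<and>
    \<rho> = rho_part m \<gamma> \<sigma>"
proof -
  have "is_partition P" if "\<forall>x\<in>#P. c \<le> x \<and> [x = c] (mod m)" "c > 0" for P c
    unfolding is_partition_def using that less_le_trans by blast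
  then show ?thesis
    unfolding copartition_def prod.case eq_rho_part_iff[symmetric]
    using assms is_partition_rho_part by metis
qed

lemma cp_eq_card:
  assumes "a > 0" "b > 0" "m > 0"
  shows "cp a b m N = card {(\<gamma>, \<sigma>). (\<forall>x\<in>#\<gamma>. a \<le> x \<and> [x = a] (mod m)) \<and>
    (\<forall>x\<in>#\<sigma>. b \<le> x \<and> [x = b] (mod m)) \<and> sum_mset \<gamma> + m * size \<gamma> * size \<sigma> + sum_mset \<sigma> = N}"
    (is "_ = card ?E")
proof -
  let ?g = "\<lambda>(\<gamma>, \<sigma>). (\<gamma>, rho_part m \<gamma> \<sigma>, \<sigma>)"
  have "c \<in> {c. copartition a b m c \<and> copartition_size c = N} \<longleftrightarrow> c \<in> ?g ` ?E" for c
  proof -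
    obtain \<gamma> \<rho> \<sigma> where c: "c = (\<gamma>, \<rho>, \<sigma>)" by (cases c)
    have "c \<in> ?g ` ?E \<longleftrightarrow> (\<gamma>, \<sigma>) \<in> ?E \<and> \<rho> = rho_part m \<gamma> \<sigma>"
      unfolding c image_iff Bex_def split_paired_Ex prod.case prod.inject by blast
    also have "\<dots> \<longleftrightarrow> c \<in> {c. copartition a b m c \<and> copartition_size c = N}"
      unfolding c mem_Collect_eq prod.case copartition_iff[OF assms] copartition_size_def
      using sum_mset_rho_part by metis
    finally show ?thesis ..
  qed
  then have "{c. copartition a b m c \<and> copartition_size c = N} = ?g ` ?E"
    by blast
  moreover have "inj_on ?g ?E"
    by (rule inj_onI) (simp split: prod.splits)
  ultimately show ?thesis
    unfolding cp_def by (simp only: card_image)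
qed

lemma cp_eq_sum:
  fixes a b m N :: nat
  assumes a: "a > 0" and b: "b > 0" and m: "m > 0"
  shows "cp a b m N = (\<Sum>(n, k)\<in>{..N} \<times> {..N}. \<Sum>s | m * n * k + s \<le> N.
    card (ap_partitions a m n s) * card (ap_partitions b m k (N - m * n * k - s)))"
proof -
  define I where "I = (SIGMA p:{..N} \<times> {..N}. {s. m * fst p * snd p + s \<le> N})"
  let ?A = "\<lambda>((n, k), s). ap_partitions a m n s \<times> ap_partitions b m k (N - m * n * k - s)"
  let ?E = "{(\<gamma>, \<sigma>). (\<forall>x\<in>#\<gamma>. a \<le> x \<and> [x = a] (mod m)) \<and>
    (\<forall>x\<in>#\<sigma>. b \<le> x \<and> [x = b] (mod m)) \<and> sum_mset \<gamma> + m * size \<gamma> * size \<sigma> + sum_mset \<sigma> = N}"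
  have fin: "finite {s. c + s \<le> N}" for c
    by (rule finite_subset[of _ "{..N}"]) auto
  have "?E = (\<Union>i\<in>I. ?A i)"
  proof (intro equalityI subsetI)
    fix d assume "d \<in> ?E"
    then obtain \<gamma> \<sigma> where d: "d = (\<gamma>, \<sigma>)"
      and \<gamma>: "\<forall>x\<in>#\<gamma>. a \<le> x \<and> [x = a] (mod m)" and \<sigma>: "\<forall>x\<in>#\<sigma>. b \<le> x \<and> [x = b] (mod m)"
      and size: "sum_mset \<gamma> + m * size \<gamma> * size \<sigma> + sum_mset \<sigma> = N"
      by blast
    have "size P \<le> sum_mset P" if "\<forall>x\<in>#P. c \<le> x \<and> [x = c] (mod m)" "c > 0" for P c
      by (rule size_le_sum_mset_if_is_partition)
        (unfold is_partition_def, use that less_le_trans in blast)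
    from this[OF \<gamma> a] this[OF \<sigma> b] have "((size \<gamma>, size \<sigma>), sum_mset \<gamma>) \<in> I"
      using size unfolding I_def mem_Sigma_iff mem_Collect_eq fst_conv snd_conv atMost_iff by linarith
    moreover have "sum_mset \<sigma> = N - m * size \<gamma> * size \<sigma> - sum_mset \<gamma>"
      using size by linarith
    then have "d \<in> ?A ((size \<gamma>, size \<sigma>), sum_mset \<gamma>)"
      unfolding d ap_partitions_def prod.case mem_Sigma_iff mem_Collect_eq using \<gamma> \<sigma> by blast
    ultimately show "d \<in> (\<Union>i\<in>I. ?A i)"
      by (rule UN_I)
  next
    fix d assume "d \<in> (\<Union>i\<in>I. ?A i)"
    then obtain i where i: "i \<in> I" "d \<in> ?A i" by (rule UN_E)
    obtain n k s where nks: "i = ((n, k), s)" by (metis surj_pair)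
    obtain \<gamma> \<sigma> where d: "d = (\<gamma>, \<sigma>)" by (cases d)
    have "m * n * k + s \<le> N"
      using i(1) unfolding nks I_def by simp
    moreover have "\<gamma> \<in> ap_partitions a m n s" "\<sigma> \<in> ap_partitions b m k (N - m * n * k - s)"
      using i(2) unfolding nks d by simp_all
    ultimately show "d \<in> ?E"
      unfolding d ap_partitions_def mem_Collect_eq prod.case by auto
  qed
  then have "cp a b m N = card (\<Union>i\<in>I. ?A i)"
    by (simp only: cp_eq_card[OF assms])
  also have "\<dots> = (\<Sum>i\<in>I. card (?A i))"
  proof (rule card_UN_disjoint)
    show "finite I"
      unfolding I_def using fin by auto
    show "\<forall>i\<in>I. finite (?A i)"
      using a b by (auto intro!: finite_ap_partitions)
    show "\<forall>i\<in>I. \<forall>j\<in>I. i \<noteq> j \<longrightarrow> ?A i \<inter> ?A j = {}"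
      by (auto simp: ap_partitions_def)
  qed
  also have "\<dots> = (\<Sum>p\<in>{..N} \<times> {..N}. \<Sum>s | m * fst p * snd p + s \<le> N. card (?A (p, s)))"
    unfolding I_def by (subst sum.Sigma) (use fin in \<open>auto simp: case_prod_beta'\<close>)
  finally show ?thesis
    by (simp add: case_prod_beta' card_cartesian_product)
qed

text \<open>
  The generating function of copartitions as a double series over the numbers \<open>n\<close> and \<open>k\<close> of parts of
  \<open>\<gamma>\<close> and \<open>\<sigma>\<close>; the factor \<open>Q^(nk)\<close> is contributed by \<open>\<rho>\<close>.
\<close>

lemma has_sum_cp:
  fixes a b m :: nat
  assumes a: "a > 0" and b: "b > 0" and m: "m > 0"
  defines "Q \<equiv> fps_X ^ m :: 'a::field_char_0 fps"
  shows "((\<lambda>(n, k). Q ^ (n * k) * ((fps_X ^ a) ^ n * inv_qfact Q n) * ((fps_X ^ b) ^ k * inv_qfact Q k))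
    has_sum Abs_fps (\<lambda>n. of_nat (cp a b m n))) UNIV"
proof (rule has_sum_fpsI_support[of "\<lambda>N. {..N} \<times> {..N}"])
  let ?F = "\<lambda>a n. (fps_X ^ a) ^ n * inv_qfact Q n"
  show "finite ({..N} \<times> {..N})" for N :: nat by simp
  show "(case p of (n, k) \<Rightarrow> Q ^ (n * k) * ?F a n * ?F b k) $ N = 0"
    if "p \<notin> {..N} \<times> {..N}" for p N
  proof -
    obtain n k where p: "p = (n, k)" by fastforce
    have "n \<le> a * n" "k \<le> b * k"
      using a b by simp_all
    then have "N < a * n + b * k"
      using that unfolding p mem_Times_iff fst_conv snd_conv atMost_iff by linarith
    moreover have "Q ^ (n * k) * ?F a n * ?F b k =
        fps_X ^ (a * n + b * k) * (Q ^ (n * k) * inv_qfact Q n * inv_qfact Q k)"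
      by (simp only: power_add power_mult mult_ac)
    ultimately show ?thesis
      by (simp only: p prod.case fps_X_power_mult_nth if_True)
  qed
  show "Abs_fps (\<lambda>n. of_nat (cp a b m n)) $ N =
      (\<Sum>p\<in>{..N} \<times> {..N}. (case p of (n, k) \<Rightarrow> Q ^ (n * k) * ?F a n * ?F b k) $ N)" for N
  proof -
    have coeff: "(Q ^ (n * k) * ?F a n * ?F b k) $ N = (\<Sum>s | m * n * k + s \<le> N.
        of_nat (card (ap_partitions a m n s) * card (ap_partitions b m k (N - m * n * k - s))))" for n k
    proof -
      have eq: "Q ^ (n * k) * ?F a n * ?F b k = fps_X ^ (m * n * k) * (?F a n * ?F b k)"
        by (simp only: Q_def power_mult[symmetric] mult.assoc)
      have F: "?F a n $ s = of_nat (card (ap_partitions a m n s))"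
        "?F b k $ s = of_nat (card (ap_partitions b m k s))" for s
        unfolding Q_def by (simp_all only: fps_of_ap_partitions[OF m a] fps_of_ap_partitions[OF m b])
      show ?thesis
      proof (cases "N < m * n * k")
        case True
        then have "{s. m * n * k + s \<le> N} = {}" by auto
        with True show ?thesis
          by (simp only: eq fps_X_power_mult_nth if_True sum.empty)
      next
        case False
        then have "{s. m * n * k + s \<le> N} = {0..N - m * n * k}" by auto
        then show ?thesis
          using False unfolding eq fps_X_power_mult_nth
          by (simp only: if_False fps_mult_nth[of "?F a n"] F of_nat_mult)
      qed
    qed
    show ?thesis
      unfolding fps_nth_Abs_fps cp_eq_sum[OF a b m] of_nat_sum case_prod_beta'
      by (simp only: coeff of_nat_sum)
  qed
qed

section \<open>Passing to the limit\<close>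

lemma tendsto_prod_finite_fps:
  fixes f :: "'i \<Rightarrow> 'b \<Rightarrow> 'a::comm_ring_1 fps"
  assumes "\<And>i. i \<in> A \<Longrightarrow> (f i \<longlongrightarrow> L i) F"
  shows "((\<lambda>x. \<Prod>i\<in>A. f i x) \<longlongrightarrow> (\<Prod>i\<in>A. L i)) F"
  using assms by (induction A rule: infinite_finite_induct) (simp_all add: tendsto_mult_fps)

lemma qpoch_tendsto_qpoch_inf:
  fixes r s :: nat
  assumes "r > 0" "s > 0"
  shows "(\<lambda>n. qpoch (fps_X ^ r) (fps_X ^ s :: 'a::field fps) n) \<longlonglongrightarrow> qpoch_inf (fps_X ^ r) (fps_X ^ s)"
  unfolding qpoch_def by (rule has_prod_imp_tendsto'[OF has_prod_qpoch_inf[OF assms]])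

lemma qpoch_inf_nth_0:
  fixes r s :: nat
  assumes "r > 0" "s > 0"
  shows "qpoch_inf (fps_X ^ r) (fps_X ^ s :: 'a::field fps) $ 0 = 1"
proof -
  have "qpoch (fps_X ^ r) (fps_X ^ s :: 'a fps) n $ 0 = 1" for n
    using assms by (induction n) (simp_all add: qpoch_Suc)
  moreover have "\<forall>\<^sub>F n in sequentially. qpoch (fps_X ^ r) (fps_X ^ s :: 'a fps) n $ 0 =
      qpoch_inf (fps_X ^ r) (fps_X ^ s) $ 0"
    using qpoch_tendsto_qpoch_inf[OF assms] unfolding tendsto_fps_iff by blast
  ultimately show ?thesis
    by simp
qed

lemma qpoch_inf_mult_inverse:
  fixes r s :: nat
  assumes "r > 0" "s > 0"
  shows "qpoch_inf (fps_X ^ r) (fps_X ^ s :: 'a::field fps) * inverse (qpoch_inf (fps_X ^ r) (fps_X ^ s)) = 1"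
  by (rule inverse_mult_eq_1') (simp add: qpoch_inf_nth_0[OF assms])

lemma inv_qfact_tendsto:
  fixes s :: nat
  assumes "s > 0"
  shows "(\<lambda>n. inv_qfact (fps_X ^ s :: 'a::field fps) n) \<longlonglongrightarrow> inverse (qpoch_inf (fps_X ^ s) (fps_X ^ s))"
  unfolding inv_qfact_def
  by (intro tendsto_inverse_fps qpoch_tendsto_qpoch_inf) (simp_all add: assms qpoch_inf_nth_0)

lemma inv_qfact_int_tendsto:
  fixes s :: nat and k :: int
  assumes "s > 0"
  shows "(\<lambda>n. inv_qfact_int (fps_X ^ s :: 'a::field fps) (int n + k)) \<longlonglongrightarrow> inverse (qpoch_inf (fps_X ^ s) (fps_X ^ s))"
proof -
  have "filterlim (\<lambda>n. nat (int n + k)) sequentially sequentially"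
    unfolding filterlim_at_top
  proof
    fix Z
    show "\<forall>\<^sub>F n in sequentially. Z \<le> nat (int n + k)"
      using eventually_ge_at_top[of "Z + nat (- k)"] by eventually_elim linarith
  qed
  then have "(\<lambda>n. inv_qfact (fps_X ^ s :: 'a fps) (nat (int n + k))) \<longlonglongrightarrow> inverse (qpoch_inf (fps_X ^ s) (fps_X ^ s))"
    by (rule filterlim_compose[OF inv_qfact_tendsto[OF assms]])
  moreover have "\<forall>\<^sub>F n in sequentially.
      inv_qfact (fps_X ^ s :: 'a fps) (nat (int n + k)) = inv_qfact_int (fps_X ^ s) (int n + k)"
    using eventually_ge_at_top[of "nat (- k)"]
    by eventually_elim (simp add: inv_qfact_int_def)
  ultimately show ?thesis
    by (rule Lim_transform_eventually)
qed

lemma qpoch_0_left [simp]: "qpoch 0 Q n = 1"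
  by (simp add: qpoch_def)

text \<open>
  A finite form of the product formula for the generating function of copartitions. The sum over \<open>k\<close>
  is evaluated by \<open>q_Vandermonde\<close> at \<open>(y Q^n, 0)\<close>, the remaining sum over \<open>n\<close> by \<open>q_Vandermonde\<close> at
  \<open>(x, y)\<close>. The weights in the second line are chosen such that they converge to a constant that does
  not depend on \<open>n\<close> and \<open>k\<close>.
\<close>

lemma finite_copartition_identity:
  fixes Q :: "'a::field fps"
  assumes Q: "Q $ 0 = 0" and xy: "x * y = Q"
  shows "(\<Sum>(n, k)\<in>{..K} \<times> {..K}. Q ^ (n * k) * (x ^ n * inv_qfact Q n) * (y ^ k * inv_qfact Q k) *
     (qpoch y Q (n + (K - k)) * inv_qfact Q (K - k) * (qpoch x Q (K - n) * inv_qfact Q (K - n)))) =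
    inv_qfact Q K"
proof -
  let ?u = "inv_qfact Q"
  have inner: "(\<Sum>k\<le>K. Q ^ (n * k) * (x ^ n * ?u n) * (y ^ k * ?u k) *
      (qpoch y Q (n + (K - k)) * ?u (K - k) * (qpoch x Q (K - n) * ?u (K - n)))) =
    ?u n * ?u (K - n) * (x ^ n * qpoch y Q n * qpoch x Q (K - n)) * ?u K" for n
  proof -
    let ?c = "?u n * ?u (K - n) * (x ^ n * qpoch y Q n * qpoch x Q (K - n))"
    have "(\<Sum>k\<le>K. Q ^ (n * k) * (x ^ n * ?u n) * (y ^ k * ?u k) *
        (qpoch y Q (n + (K - k)) * ?u (K - k) * (qpoch x Q (K - n) * ?u (K - n)))) =
      ?c * (\<Sum>k\<le>K. ?u k * ?u (K - k) * ((y * Q ^ n) ^ k * qpoch 0 Q k * qpoch (y * Q ^ n) Q (K - k)))"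
      unfolding sum_distrib_left
      by (rule sum.cong[OF refl],
          simp only: qpoch_add power_mult_distrib power_mult qpoch_0_left mult_1_right)
        (simp only: mult_ac)
    also have "\<dots> = ?c * ?u K"
      unfolding q_Vandermonde[OF Q] by simp
    finally show ?thesis .
  qed
  have "(\<Sum>n\<le>K. ?u n * ?u (K - n) * (x ^ n * qpoch y Q n * qpoch x Q (K - n)) * ?u K) =
      qpoch Q Q K * ?u K * ?u K"
    unfolding sum_distrib_right[symmetric] q_Vandermonde[OF Q] xy ..
  also have "\<dots> = ?u K"
    by (simp add: qpoch_mult_inv_qfact[OF Q])
  finally show ?thesis
    by (simp only: sum.cartesian_product[symmetric] inner)
qed

text \<open>
  In the usual notation, \<open>\<Sum>_n cp_(a,b,a+b)(n) q^n = (q^m; q^m)_\<infinity> / ((q^a; q^m)_\<infinity> (q^b; q^m)_\<infinity>)\<close> with \<open>m = a + b\<close>.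
\<close>

lemma fps_cp_eq:
  fixes a b m :: nat
  assumes a: "a > 0" and b: "b > 0" and m: "m = a + b"
  defines "P \<equiv> \<lambda>r. qpoch_inf (fps_X ^ r) (fps_X ^ m :: 'a::field_char_0 fps)"
  shows "P a * P b * Abs_fps (\<lambda>n. of_nat (cp a b m n)) = P m"
proof -
  let ?Q = "fps_X ^ m :: 'a fps" and ?x = "fps_X ^ a :: 'a fps" and ?y = "fps_X ^ b :: 'a fps"
  let ?u = "inv_qfact ?Q" and ?S = "Abs_fps (\<lambda>n. of_nat (cp a b m n)) :: 'a fps"
  let ?C = "\<lambda>(n, k). ?Q ^ (n * k) * (?x ^ n * ?u n) * (?y ^ k * ?u k)"
  let ?f = "\<lambda>K (n, k). qpoch ?y ?Q (n + (K - k)) * ?u (K - k) * (qpoch ?x ?Q (K - n) * ?u (K - n))"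
  have m0: "m > 0" using a m by simp
  have Q: "?Q $ 0 = 0" using m0 by simp
  define U where "U = inverse (P m)"
  have U: "P m * U = 1"
    unfolding U_def P_def by (rule qpoch_inf_mult_inverse[OF m0 m0])
  have u: "?u \<longlonglongrightarrow> U"
    unfolding U_def P_def by (rule inv_qfact_tendsto[OF m0])
  have diff: "filterlim (\<lambda>K. c + (K - k)) sequentially sequentially" for c k :: nat
    unfolding filterlim_at_top
  proof
    fix Z
    show "\<forall>\<^sub>F K in sequentially. Z \<le> c + (K - k)"
      using eventually_ge_at_top[of "Z + k"] by eventually_elim linarith
  qed
  have f: "(\<lambda>K. ?f K p) \<longlonglongrightarrow> P b * U * (P a * U)" for p
  proof -
    obtain n k where p: "p = (n, k)" by fastforce
    have "(\<lambda>K. qpoch ?y ?Q (n + (K - k)) * ?u (0 + (K - k)) * (qpoch ?x ?Q (0 + (K - n)) * ?u (0 + (K - n))))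
        \<longlonglongrightarrow> P b * U * (P a * U)"
      unfolding P_def
      by (intro tendsto_mult_fps filterlim_compose[OF qpoch_tendsto_qpoch_inf diff] filterlim_compose[OF u diff])
        (use a b m0 in simp_all)
    then show ?thesis by (simp add: p)
  qed
  have lim: "(\<lambda>K. \<Sum>p\<in>{..K} \<times> {..K}. ?C p * ?f K p) \<longlonglongrightarrow> ?S * (P b * U * (P a * U))"
  proof (rule tannery_fps[OF has_sum_cp[OF a b m0] f])
    fix p :: "nat \<times> nat"
    show "\<forall>\<^sub>F K in sequentially. p \<in> {..K} \<times> {..K}"
      using eventually_ge_at_top[of "max (fst p) (snd p)"] by eventually_elim (simp add: mem_Times_iff)
  qed simp
  have xy: "?x * ?y = ?Q"
    unfolding m by (rule power_add[symmetric])
  have "(\<Sum>p\<in>{..K} \<times> {..K}. ?C p * ?f K p) = ?u K" for K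
    using finite_copartition_identity[OF Q xy, of K] by (simp only: case_prod_beta')
  then have "?u \<longlonglongrightarrow> ?S * (P b * U * (P a * U))"
    using lim by (simp only:)
  then have "?S * (P b * U * (P a * U)) = U"
    by (rule LIMSEQ_unique[OF _ u])
  then have "P m * P m * (?S * (P b * U * (P a * U))) = P m * P m * U"
    by simp
  also have "P m * P m * (?S * (P b * U * (P a * U))) = (P a * P b * ?S) * (P m * U) * (P m * U)"
    by (simp only: mult_ac)
  also have "P m * P m * U = P m * (P m * U)"
    by (simp only: mult_ac)
  finally show ?thesis
    by (simp add: U)
qed

text \<open>
  The theta coefficients that remain after two steps along the Bailey chain in base \<open>q\<close> are those of a
  triple product in base \<open>q^5\<close>; here \<open>x\<close> and \<open>y\<close> are \<open>q^2\<close> and \<open>q^3\<close> for \<open>r = 0\<close>, and \<open>q^4\<close> and \<open>q\<close> for \<open>r = 1\<close>.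
\<close>

lemma jtp_coeff_rogers_ramanujan:
  assumes r: "r \<le> 1"
  shows "jtp_coeff 1 (fps_X :: 'a::comm_ring_1 fps) fps_X j * fps_X ^ (2 * nat (j\<^sup>2 + int r * j)) =
    jtp_coeff (fps_X ^ (2 + 2 * r)) (fps_X ^ (3 - 2 * r)) (fps_X ^ 5) j"
proof (cases "j \<ge> 0")
  case True
  then obtain i where j: "j = int i"
    using nonneg_int_cases by blast
  have "nat (j\<^sup>2 + int r * j) = i\<^sup>2 + r * i"
    unfolding j by (simp add: nat_add_distrib nat_mult_distrib nat_power_eq)
  moreover have "(i choose 2) + 2 * (i\<^sup>2 + r * i) = (2 + 2 * r) * i + 5 * (i choose 2)"
    using square_eq_choose_2[of i] by (simp add: power2_eq_square algebra_simps)
  ultimately show ?thesis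
    unfolding j jtp_coeff_of_nat
    by (simp only: power_mult[symmetric] mult.assoc power_add[symmetric] power_one mult_1_left)
next
  case False
  then have "j \<le> 0" by simp
  then obtain i where j: "j = - int i"
    by (rule nonpos_int_cases)
  consider "r = 0" | "r = 1" using r by linarith
  then have "i + (i choose 2) + 2 * nat (j\<^sup>2 + int r * j) = (3 - 2 * r) * i + 5 * (i choose 2)"
  proof cases
    case 1
    then show ?thesis
      using square_eq_choose_2[of i] by (simp add: j power2_eq_square nat_mult_distrib)
  next
    case 2
    have "j\<^sup>2 + int r * j = int (2 * (i choose 2))"
      using square_eq_choose_2[of i] 2 by (simp add: j power2_eq_square flip: of_nat_mult)
    then have "nat (j\<^sup>2 + int r * j) = 2 * (i choose 2)"
      by (simp only: nat_int)
    then show ?thesis using 2 by simp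
  qed
  then show ?thesis
    unfolding j jtp_coeff_minus_of_nat
    by (simp only: power_mult[symmetric] mult.assoc power_add[symmetric] add.assoc)
qed

lemma summable_jtp_coeff:
  fixes a b c :: nat
  assumes "a > 0" "b > 0"
  shows "jtp_coeff (fps_X ^ a) (fps_X ^ b) (fps_X ^ c :: 'a::comm_ring_1 fps) summable_on UNIV"
proof (rule summable_on_fpsI[of "\<lambda>n. {- int n..int n}"])
  fix n and j :: int assume j: "j \<notin> {- int n..int n}"
  have zero: "((-1) ^ i * (fps_X ^ d) ^ i * (fps_X ^ c) ^ (i choose 2) :: 'a fps) $ n = 0"
    if "d > 0" "n < i" for d i
  proof -
    have "i \<le> d * i" using that by simp
    then have "n < d * i" using that by linarith
    moreover have "(-1) ^ i * (fps_X ^ d) ^ i * (fps_X ^ c) ^ (i choose 2) =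
        (fps_X ^ (d * i) * ((-1) ^ i * (fps_X ^ c) ^ (i choose 2)) :: 'a fps)"
      by (simp only: power_mult mult_ac)
    ultimately show ?thesis
      by (simp only: fps_X_power_mult_nth if_True)
  qed
  show "jtp_coeff (fps_X ^ a) (fps_X ^ b) (fps_X ^ c :: 'a fps) j $ n = 0"
    unfolding jtp_coeff_def using zero[OF assms(1)] zero[OF assms(2)] j by auto
qed simp

lemma tendsto_bilateral_sum:
  fixes C :: "int \<Rightarrow> 'a::field fps" and s r :: nat
  assumes s: "s > 0" and C: "(C has_sum \<Theta>) UNIV"
  defines "U \<equiv> inverse (qpoch_inf (fps_X ^ s) (fps_X ^ s :: 'a fps))"
  shows "(\<lambda>n. \<Sum>j = - int (n + r)..int n. C j *
     (inv_qfact_int (fps_X ^ s) (int n - j) * inv_qfact_int (fps_X ^ s) (int (n + r) + j))) \<longlonglongrightarrow> \<Theta> * (U * U)"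
proof (rule tannery_fps[OF C])
  fix j
  show "(\<lambda>n. inv_qfact_int (fps_X ^ s) (int n - j) * inv_qfact_int (fps_X ^ s) (int (n + r) + j))
      \<longlonglongrightarrow> U * U"
    using inv_qfact_int_tendsto[OF s, of "- j", where 'a = 'a]
      inv_qfact_int_tendsto[OF s, of "int r + j", where 'a = 'a]
    unfolding U_def by (intro tendsto_mult_fps) (simp_all add: add.assoc)
  show "\<forall>\<^sub>F n in sequentially. j \<in> {- int (n + r)..int n}"
    using eventually_ge_at_top[of "nat \<bar>j\<bar>"] by eventually_elim auto
qed simp

lemma jacobi_triple_product:
  fixes a b c :: nat
  assumes a: "a > 0" and b: "b > 0" and c: "c = a + b"
    and \<Theta>: "(jtp_coeff (fps_X ^ a) (fps_X ^ b) (fps_X ^ c :: 'a::field fps) has_sum \<Theta>) UNIV"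
  shows "\<Theta> = qpoch_inf (fps_X ^ a) (fps_X ^ c) * qpoch_inf (fps_X ^ b) (fps_X ^ c) * qpoch_inf (fps_X ^ c) (fps_X ^ c)"
proof -
  let ?Q = "fps_X ^ c :: 'a fps"
  define P where "P = (\<lambda>r::nat. qpoch_inf (fps_X ^ r) ?Q)"
  define U where "U = inverse (P c)"
  have c0: "c > 0" using a c by simp
  have U: "P c * U = 1"
    unfolding U_def P_def by (rule qpoch_inf_mult_inverse[OF c0 c0])
  have Q: "?Q $ 0 = 0"
    using c0 by simp
  have "(fps_X ^ a) * (fps_X ^ b) = ?Q"
    unfolding c by (rule power_add[symmetric])
  then have finite: "jtp_sum (fps_X ^ a) (fps_X ^ b) ?Q n n =
      qpoch (fps_X ^ a) ?Q n * qpoch (fps_X ^ b) ?Q n * inv_qfact ?Q (n + n)" for n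
    by (rule finite_jacobi_triple_product[OF Q])
  have lim: "(\<lambda>n. jtp_sum (fps_X ^ a) (fps_X ^ b) ?Q n n) \<longlonglongrightarrow> \<Theta> * (U * U)"
    using tendsto_bilateral_sum[OF c0 \<Theta>, of 0] unfolding jtp_sum_def U_def P_def by simp
  have double: "filterlim (\<lambda>n::nat. n + n) sequentially sequentially"
    by (rule filterlim_subseq) (simp add: strict_mono_def)
  have "(\<lambda>n. qpoch (fps_X ^ a) ?Q n * qpoch (fps_X ^ b) ?Q n * inv_qfact ?Q (n + n))
      \<longlonglongrightarrow> P a * P b * U"
    unfolding P_def U_def
    by (intro tendsto_mult_fps qpoch_tendsto_qpoch_inf a b c0
        filterlim_compose[OF inv_qfact_tendsto[OF c0] double])
  with lim have "\<Theta> * (U * U) = P a * P b * U"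
    unfolding finite by (rule LIMSEQ_unique)
  then have "P c * P c * (\<Theta> * (U * U)) = P c * P c * (P a * P b * U)"
    by simp
  then have "\<Theta> * (P c * U) * (P c * U) = P a * P b * P c * (P c * U)"
    by (simp only: mult_ac)
  then show ?thesis
    unfolding U mult_1_right by (simp only: P_def)
qed

text \<open>
  The Rogers--Ramanujan identities: \<open>finite_rogers_ramanujan\<close> in the limit \<open>n \<rightarrow> \<infinity>\<close>, combined with the
  triple product identity in base \<open>q^5\<close>, and with \<open>(q; q)_\<infinity>\<close> multiplied out.
\<close>

lemma rogers_ramanujan_theta:
  fixes r :: nat
  assumes r: "r \<le> 1"
  shows "(\<Sum>s. fps_X ^ (s\<^sup>2 + r * s) * inv_qfact fps_X s) * qpoch_inf fps_X (fps_X :: 'a::field fps) =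
    qpoch_inf (fps_X ^ (2 + 2 * r)) (fps_X ^ 5) * qpoch_inf (fps_X ^ (3 - 2 * r)) (fps_X ^ 5) *
    qpoch_inf (fps_X ^ 5) (fps_X ^ 5)"
proof -
  let ?q = "fps_X :: 'a fps"
  let ?t = "\<lambda>s. ?q ^ (s\<^sup>2 + r * s) * inv_qfact ?q s"
  define R where "R = (\<Sum>s. ?t s)"
  have summable: "?t summable_on UNIV"
  proof (rule summable_on_fpsI[of "\<lambda>n. {..n}"])
    fix s n :: nat assume "s \<notin> {..n}"
    moreover have "s \<le> s\<^sup>2 + r * s"
      by (simp add: power2_eq_square trans_le_add1)
    ultimately have "n < s\<^sup>2 + r * s"
      unfolding atMost_iff by linarith
    then show "?t s $ n = 0"
      by (simp only: fps_X_power_mult_nth if_True)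
  qed simp
  have "?t sums infsum ?t UNIV"
    by (rule has_sum_imp_sums[OF has_sum_infsum[OF summable]])
  then have R: "(?t has_sum R) UNIV"
    unfolding R_def using has_sum_infsum[OF summable] by (simp only: sums_unique[symmetric])
  define U where "U = inverse (qpoch_inf ?q ?q)"
  have U: "qpoch_inf ?q ?q * U = 1"
    using qpoch_inf_mult_inverse[of 1 1] by (simp add: U_def)
  define C where "C = jtp_coeff (?q ^ (2 + 2 * r)) (?q ^ (3 - 2 * r)) (?q ^ 5)"
  have "C summable_on UNIV"
    unfolding C_def by (rule summable_jtp_coeff) (use r in auto)
  then obtain \<Theta> where \<Theta>: "(C has_sum \<Theta>) UNIV"
    unfolding summable_on_def by blast
  have product: "\<Theta> = qpoch_inf (?q ^ (2 + 2 * r)) (?q ^ 5) * qpoch_inf (?q ^ (3 - 2 * r)) (?q ^ 5) *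
      qpoch_inf (?q ^ 5) (?q ^ 5)"
    by (rule jacobi_triple_product[OF _ _ _ \<Theta>[unfolded C_def]]) (use r in linarith)+
  have "(\<lambda>n. inv_qfact ?q (n - s)) \<longlonglongrightarrow> U" for s
  proof -
    have "(\<lambda>n. inv_qfact ?q n) \<longlonglongrightarrow> U"
      using inv_qfact_tendsto[of 1] by (simp add: U_def)
    then show ?thesis
      by (rule filterlim_compose) (rule filterlim_minus_const_nat_at_top)
  qed
  then have lim: "(\<lambda>n. \<Sum>s\<le>n. ?q ^ (s\<^sup>2 + r * s) * inv_qfact ?q s * inv_qfact ?q (n - s)) \<longlonglongrightarrow> R * U"
    by (rule tannery_fps[OF R]) (simp_all add: eventually_ge_at_top)
  have finite: "(\<Sum>s\<le>n. ?q ^ (s\<^sup>2 + r * s) * inv_qfact ?q s * inv_qfact ?q (n - s)) =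
      (\<Sum>j = - int (n + r)..int n. C j * (inv_qfact_int ?q (int n - j) * inv_qfact_int ?q (int (n + r) + j)))" for n
    unfolding C_def jtp_coeff_rogers_ramanujan[OF r, symmetric]
    by (rule finite_rogers_ramanujan) (use r in simp_all)
  have "(\<lambda>n. \<Sum>j = - int (n + r)..int n. C j *
      (inv_qfact_int ?q (int n - j) * inv_qfact_int ?q (int (n + r) + j))) \<longlonglongrightarrow> \<Theta> * (U * U)"
    using tendsto_bilateral_sum[of 1, OF _ \<Theta>, of r] by (simp add: U_def)
  with lim have "R * U = \<Theta> * (U * U)"
    unfolding finite by (rule LIMSEQ_unique)
  then have "qpoch_inf ?q ?q * qpoch_inf ?q ?q * (R * U) = qpoch_inf ?q ?q * qpoch_inf ?q ?q * (\<Theta> * (U * U))"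
    by simp
  then have "R * qpoch_inf ?q ?q * (qpoch_inf ?q ?q * U) = \<Theta> * (qpoch_inf ?q ?q * U) * (qpoch_inf ?q ?q * U)"
    by (simp only: mult_ac)
  then show ?thesis
    unfolding U mult_1_right by (simp only: product R_def)
qed

lemma qpoch_inf_dissection:
  fixes m :: nat
  assumes m: "m > 0"
  shows "qpoch_inf (fps_X :: 'a::field fps) fps_X = (\<Prod>r=1..m. qpoch_inf (fps_X ^ r) (fps_X ^ m))"
proof -
  let ?q = "fps_X :: 'a fps"
  have finite: "qpoch ?q ?q (n * m) = (\<Prod>r=1..m. qpoch (?q ^ r) (?q ^ m) n)" for n
  proof (induction n)
    case (Suc n)
    have "qpoch ?q ?q (Suc n * m) = qpoch ?q ?q (n * m) * qpoch (?q * ?q ^ (n * m)) ?q m"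
      unfolding mult_Suc add.commute[of m] by (rule qpoch_add)
    also have "qpoch (?q * ?q ^ (n * m)) ?q m = (\<Prod>k<m. 1 - ?q ^ Suc k * (?q ^ m) ^ n)"
      unfolding qpoch_def by (rule prod.cong) (simp_all add: power_mult[symmetric] mult_ac)
    also have "\<dots> = (\<Prod>r=1..m. 1 - ?q ^ r * (?q ^ m) ^ n)"
      unfolding One_nat_def by (rule prod.atLeast1_atMost_eq[symmetric])
    finally show ?case
      unfolding Suc.IH qpoch_Suc prod.distrib .
  qed simp
  have "filterlim (\<lambda>n. n * m) sequentially sequentially"
    using m by (intro filterlim_subseq) (simp add: strict_mono_def)
  moreover have "qpoch ?q ?q \<longlonglongrightarrow> qpoch_inf ?q ?q"
    using qpoch_tendsto_qpoch_inf[of 1 1, where 'a = 'a] by simp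
  ultimately have "(\<lambda>n. qpoch ?q ?q (n * m)) \<longlonglongrightarrow> qpoch_inf ?q ?q"
    by (rule filterlim_compose[rotated])
  moreover have "(\<lambda>n. \<Prod>r=1..m. qpoch (?q ^ r) (?q ^ m) n) \<longlonglongrightarrow>
      (\<Prod>r=1..m. qpoch_inf (?q ^ r) (?q ^ m))"
    using m by (intro tendsto_prod_finite_fps qpoch_tendsto_qpoch_inf) simp_all
  ultimately show ?thesis
    unfolding finite by (rule LIMSEQ_unique)
qed

theorem corollary4p3:
  shows "(rogers_ramanujan_G :: 'a::field_char_0 fps) =
           1 / qpoch_inf (fps_X ^ 5) (fps_X ^ 5) * Abs_fps (\<lambda>n. of_nat (cp 1 4 5 n)) \<and>
         (rogers_ramanujan_H :: 'a fps) =
           1 / qpoch_inf (fps_X ^ 5) (fps_X ^ 5) * Abs_fps (\<lambda>n. of_nat (cp 2 3 5 n))"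
proof -
  let ?q = "fps_X :: 'a fps"
  define P where "P = (\<lambda>r::nat. qpoch_inf (?q ^ r) (?q ^ 5))"
  have nz: "P r \<noteq> 0" if "r > 0" for r
    using qpoch_inf_nth_0[OF that, of 5, where 'a = 'a] unfolding P_def by (metis fps_zero_nth zero_neq_one zero_less_numeral)
  have prod_5: "(\<Prod>r=1..5. f r) = f 1 * f 2 * f 3 * f 4 * f 5" for f :: "nat \<Rightarrow> 'a fps"
  proof -
    have "{1..5::nat} = {1, 2, 3, 4, 5}" by auto
    then show ?thesis by (simp add: mult.assoc)
  qed
  have dissect: "qpoch_inf ?q ?q = P 1 * P 2 * P 3 * P 4 * P 5"
    using qpoch_inf_dissection[of 5, where 'a = 'a] prod_5[of P] by (simp add: P_def)
  \<comment> \<open>both identities arise by cancelling \<open>(q; q)_\<infinity> = P 1 * P 2 * P 3 * P 4 * P 5\<close>\<close>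
  have cancel: "R = 1 / P 5 * S"
    if R: "R * qpoch_inf ?q ?q = P c * P d * P 5" and S: "P a * P b * S = P 5"
      and abcd: "P a * P b * (P c * P d) = P 1 * P 2 * P 3 * P 4"
      and pos: "a > 0" "b > 0" "c > 0" "d > 0"
    for R S :: "'a fps" and a b c d :: nat
  proof -
    have "(P a * P b * R) * (P c * P d * P 5) = R * qpoch_inf ?q ?q"
      unfolding dissect abcd[symmetric] by (simp only: mult_ac)
    then have "P a * P b * R = 1"
      using R nz pos by simp
    then have "P a * P b * (P 5 * R) = P a * P b * S"
      using S by (simp add: mult_ac)
    then have "P 5 * R = S"
      using nz pos by simp
    moreover have "1 / P 5 = inverse (P 5)"
      unfolding P_def by (subst fps_divide_unit) (simp_all add: qpoch_inf_nth_0)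
    moreover have "inverse (P 5) * P 5 = 1"
      unfolding P_def by (rule inverse_mult_eq_1) (simp add: qpoch_inf_nth_0)
    ultimately show ?thesis
      by (metis mult.assoc mult_1_left)
  qed
  have div: "?q ^ k / qpoch ?q ?q n = ?q ^ k * inv_qfact ?q n" for k n
    unfolding inv_qfact_def by (subst fps_divide_unit) (simp_all add: qpoch_fps_X_nth_0)
  have G: "rogers_ramanujan_G * qpoch_inf ?q ?q = P 2 * P 3 * P 5"
    using rogers_ramanujan_theta[of 0, where 'a = 'a] by (simp add: rogers_ramanujan_G_def div P_def)
  have H: "rogers_ramanujan_H * qpoch_inf ?q ?q = P 4 * P 1 * P 5"
    using rogers_ramanujan_theta[of 1, where 'a = 'a] by (simp add: rogers_ramanujan_H_def div P_def)
  have "P 1 * P 4 * Abs_fps (\<lambda>n. of_nat (cp 1 4 5 n)) = P 5"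
    unfolding P_def by (rule fps_cp_eq) simp_all
  moreover have "P 2 * P 3 * Abs_fps (\<lambda>n. of_nat (cp 2 3 5 n)) = P 5"
    unfolding P_def by (rule fps_cp_eq) simp_all
  ultimately show ?thesis
    using cancel[OF G, of 1 4] cancel[OF H, of 2 3] by (simp add: P_def mult_ac)
qed

end
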